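(* In a hypothesis testing problem, say that one is $\eta$-sure that $h\in H_1$ given data $x$, under the Bayesian method with a given prior, when the posterior probability $P(h\in H_1|x)$ equals $\eta$ (at least $\eta$ in (7)). Then any (pure) Bayesian solution, whatever the prior on $H$, satisfies all of the following criteria. (1) Complementarity: if given data $x$ one is $\eta$-sure that $H_1$ holds, with $\eta$ high (near $1$), and one sets $H_0'=H_1$, $H_1'=H_0$, then applying the same method to $H_0',H_1'$ with the same data $x$ one is $\eta'$-sure that $H_1'$ holds only for values of $\eta'$ that are low (near $0$); indeed, $\eta'$ is at most $1-\eta$. (2) Inclusion: if $H_1\subseteq H_1'\subseteq H$, then it is not possible to be more sure that $h\in H_1$ than that $h\in H_1'$; that is, $P(h\in H_1|x)\le P(h\in H_1'|x)$. (3) Intention: if data $x_1$ is collected, the resulting inference does not depend on whether or not one intended perhaps, depending only on the value of $x_1$, to collect more data $x_2$ on the same system; that is, if $S$ is the event that data collection is stopped before collecting $x_2$, where the stopping decision depends only on $x_1$ (so that $P(S|x_1,h)=P(S|x_1)$), then $P(h\in H_1|S,x_1)=P(h\in H_1|x_1)$. (4) Conjunction: let $N>1$ and consider $N$ independent and identical systems with null hypotheses $H_{0,n}$ and complementary alternative hypotheses $H_{1,n}$, $n=1,\dots,N$. If data $x_n$ is collected on each such that for some $\eta\in(0,1)$ and all $n$ one is exactly $\eta$-sure that $h_n\in H_{1,n}$, then one is strictly less than $\eta$-sure that for all $n$, $h_n\in H_{1,n}$. (5) Disjunction: let $N>1$ and consider $N$ independent systems, identical apart from the values of $h_n$, with null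 and alternative hypotheses as in (4). If data $x_n$ is collected on each such that for some $\eta\in(0,1)$ and all $n$ one is exactly $\eta$-sure that $h_n\in H_{1,n}$, then one is strictly more than $\eta$-sure that for at least one $n$, $h_n\in H_{1,n}$. (6) Multiplicity: for $N$ independent systems, identical apart from the values of $h_n$, with null and alternative hypotheses as in (4), and data $x_n$ collected on the $n$th system for each $n$, the conclusion about whether or not $h_1\in H_{1,1}$ does not depend on the value of $N$ if the value of $x_1$ remains constant. (7) Sequential Optimality: suppose that for a single system data $x_1,x_2,\dots$ are collected sequentially, all the $x_k$ being conditionally independent given $h$. Then for every $\eta\in[0,1]$ there exists a data collection and analysis plan $D$ for $\eta$ such that for all alternative plans $D'$ for $\eta$, all $h\in H_1$ and all $k\ge 0$, $p_k(D,h)\ge p_k(D',h)$.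
   Context: Setting: the unknown $h$ takes values in a space $H$ partitioned into a null hypothesis $H_0$ and an alternative $H_1$; data $x$ has a given likelihood $P(x|h)$. The Bayesian method uses a prior probability measure on $H$ (which does not depend on how $H$ is partitioned into hypotheses) and reports the posterior probability $P(h\in H_1|x)$ given by Bayes' theorem. Identities between conditional probabilities are understood for almost every data value. For several systems, $h_n$ and $x_n$ denote the unknown and the data of the $n$th system. Independent systems: the pairs $(h_n,x_n)$ are independent under the joint law of prior and likelihood. Identical systems: the systems are copies of one and the same hypothesis testing problem (in particular the same space of unknowns, hypotheses and likelihood). A data collection and analysis plan for $\eta$ is a sequence of measurable quit-probability functions $q_0, q_1(x_1), q_2(x_1,x_2),\dots$ with values in $[0,1]$ ($q_0$ a constant), such that one stops data collection immediately after collecting $x_k$ (without collecting any data, if $k=0$) if an independent uniform random number $u_k$ from $(0,1)$ is less than $q_k(x_1,\dots,x_k)$, and such that whenever one so stops one can conclude that one is $\eta$-sure that $h\in H_1$, i.e. $P(h\in H_1|x_1,\dots,x_k)\ge\eta$; otherwise one goes on collecting data for ever. $p_k(D,h)$ denotes the probability, for that particular true value of $h$, that under plan $D$ one concludes that one is $\eta$-sure that $h\in H_1$ at some point before the collection of $x_{k+1}$. *)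

theory Defs
  imports "HOL-Probability.Probability"
begin

text \<open>
  A measure such as \<open>H\<close> or \<open>X\<close> below only serves as a carrier of a measurable space.
  The likelihood \<open>P(x|h)\<close> is a Markov kernel \<open>K\<close> from \<open>H\<close> to \<open>X\<close>; it need not be dominated.
\<close>

definition testing_problem ::
    "'h measure \<Rightarrow> 'x measure \<Rightarrow> ('h \<Rightarrow> 'x measure) \<Rightarrow> 'h set \<Rightarrow> 'h set \<Rightarrow> bool" where
  "testing_problem H X K H0 H1 \<longleftrightarrow>
     H0 \<in> sets H \<and> H1 \<in> sets H \<and> H0 \<inter> H1 = {} \<and> H0 \<union> H1 = space H \<and>
     K \<in> measurable H (prob_algebra X)"

definition prior_on :: "'h measure \<Rightarrow> 'h measure \<Rightarrow> bool" where
  "prior_on H \<pi> \<longleftrightarrow> \<pi> \<in> space (prob_algebra H)"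

definition joint_law ::
    "'h measure \<Rightarrow> 'x measure \<Rightarrow> ('h \<Rightarrow> 'x measure) \<Rightarrow> 'h measure \<Rightarrow> ('h \<times> 'x) measure" where
  "joint_law H X K \<pi> = \<pi> \<bind> (\<lambda>h. K h \<bind> (\<lambda>x. return (H \<Otimes>\<^sub>M X) (h, x)))"

text \<open>
  \<open>is_cond_prob M E S Y f\<close>: the function \<open>f\<close> on the value space \<open>S\<close> of \<open>Y\<close> is a version of
  \<open>y \<mapsto> P(E | Y = y)\<close>. Versions are determined only up to null sets of the law of \<open>Y\<close>.
\<close>

definition is_cond_prob ::
    "'w measure \<Rightarrow> 'w set \<Rightarrow> 's measure \<Rightarrow> ('w \<Rightarrow> 's) \<Rightarrow> ('s \<Rightarrow> real) \<Rightarrow> bool" where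
  "is_cond_prob M E S Y f \<longleftrightarrow>
     f \<in> borel_measurable S \<and> (\<forall>y\<in>space S. 0 \<le> f y \<and> f y \<le> 1) \<and>
     (AE \<omega> in M. real_cond_exp M (vimage_algebra (space M) Y S) (indicator E) \<omega> = f (Y \<omega>))"

definition is_posterior ::
    "'h measure \<Rightarrow> 'x measure \<Rightarrow> ('h \<Rightarrow> 'x measure) \<Rightarrow> 'h measure \<Rightarrow> 'h set \<Rightarrow> ('x \<Rightarrow> real) \<Rightarrow> bool" where
  "is_posterior H X K \<pi> A f \<longleftrightarrow>
     is_cond_prob (joint_law H X K \<pi>) {z \<in> space (joint_law H X K \<pi>). fst z \<in> A} X snd f"

lemma prior_on_simps:
  assumes "prior_on H \<pi>"
  shows "prob_space \<pi>" "sets \<pi> = sets H" "space \<pi> = space H"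
  using assms by (auto simp: prior_on_def space_prob_algebra dest: sets_eq_imp_space_eq)

lemma nn_integral_joint_law:
  assumes pi: "prior_on H \<pi>" and K: "K \<in> measurable H (prob_algebra X)"
    and g: "g \<in> borel_measurable (H \<Otimes>\<^sub>M X)"
  shows "(\<integral>\<^sup>+z. g z \<partial>joint_law H X K \<pi>) = (\<integral>\<^sup>+h. \<integral>\<^sup>+x. g (h, x) \<partial>K h \<partial>\<pi>)"
proof -
  note [measurable] = g K
  have K': "K \<in> measurable H (subprob_algebra X)" by (rule measurable_prob_algebraD[OF K])
  have inner: "(\<lambda>h. K h \<bind> (\<lambda>x. return (H \<Otimes>\<^sub>M X) (h, x))) \<in> measurable H (subprob_algebra (H \<Otimes>\<^sub>M X))"
    by (rule measurable_bind[OF K']) simp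
  have inner': "(\<lambda>h. K h \<bind> (\<lambda>x. return (H \<Otimes>\<^sub>M X) (h, x))) \<in> measurable \<pi> (subprob_algebra (H \<Otimes>\<^sub>M X))"
    using inner prior_on_simps(2)[OF pi] by (simp cong: measurable_cong_sets)
  have "(\<integral>\<^sup>+z. g z \<partial>joint_law H X K \<pi>) = (\<integral>\<^sup>+h. \<integral>\<^sup>+z. g z \<partial>(K h \<bind> (\<lambda>x. return (H \<Otimes>\<^sub>M X) (h, x))) \<partial>\<pi>)"
    unfolding joint_law_def by (rule nn_integral_bind[OF g inner'])
  also have "\<dots> = (\<integral>\<^sup>+h. \<integral>\<^sup>+x. g (h, x) \<partial>K h \<partial>\<pi>)"
  proof (rule nn_integral_cong)
    fix h assume "h \<in> space \<pi>"
    then have h: "h \<in> space H" using prior_on_simps(3)[OF pi] by simp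
    have sK: "sets (K h) = sets X" using measurable_space[OF K h] by (simp add: space_prob_algebra)
    have spK: "space (K h) = space X" by (rule sets_eq_imp_space_eq[OF sK])
    have m: "(\<lambda>x. return (H \<Otimes>\<^sub>M X) (h, x)) \<in> measurable (K h) (subprob_algebra (H \<Otimes>\<^sub>M X))"
      unfolding measurable_cong_sets[OF sK refl] using h by measurable
    have "(\<integral>\<^sup>+z. g z \<partial>(K h \<bind> (\<lambda>x. return (H \<Otimes>\<^sub>M X) (h, x)))) = (\<integral>\<^sup>+x. \<integral>\<^sup>+z. g z \<partial>return (H \<Otimes>\<^sub>M X) (h, x) \<partial>K h)"
      by (rule nn_integral_bind[OF g m])
    also have "\<dots> = (\<integral>\<^sup>+x. g (h, x) \<partial>K h)"
      using h by (intro nn_integral_cong nn_integral_return) (auto simp: spK space_pair_measure)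
    finally show "(\<integral>\<^sup>+z. g z \<partial>(K h \<bind> (\<lambda>x. return (H \<Otimes>\<^sub>M X) (h, x)))) = (\<integral>\<^sup>+x. g (h, x) \<partial>K h)" .
  qed
  finally show ?thesis .
qed

lemma joint_law_simps:
  assumes pi: "prior_on H \<pi>" and K: "K \<in> measurable H (prob_algebra X)"
  shows "sets (joint_law H X K \<pi>) = sets (H \<Otimes>\<^sub>M X)" "prob_space (joint_law H X K \<pi>)"
proof -
  note [measurable] = K
  have inner: "(\<lambda>h. K h \<bind> (\<lambda>x. return (H \<Otimes>\<^sub>M X) (h, x))) \<in> measurable H (prob_algebra (H \<Otimes>\<^sub>M X))"
    by measurable
  have p: "\<pi> \<in> space (prob_algebra H)" using pi by (simp add: prior_on_def)
  show "prob_space (joint_law H X K \<pi>)" "sets (joint_law H X K \<pi>) = sets (H \<Otimes>\<^sub>M X)"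
    unfolding joint_law_def using prob_space_bind'[OF p inner] sets_bind'[OF p inner] by auto
qed

text \<open>Bayes' theorem: for a dominated likelihood the usual quotient is a posterior.\<close>

lemma bayes_formula:
  fixes p :: "'h \<Rightarrow> 'x \<Rightarrow> ennreal"
  assumes pi: "prior_on H \<pi>" and K: "K \<in> measurable H (prob_algebra X)"
    and nu: "sigma_finite_measure \<nu>" "sets \<nu> = sets X"
    and p[measurable]: "case_prod p \<in> borel_measurable (H \<Otimes>\<^sub>M X)"
    and dens: "\<And>h. h \<in> space H \<Longrightarrow> K h = density \<nu> (p h)"
    and A[measurable]: "A \<in> sets H"
  shows "is_posterior H X K \<pi> A
    (\<lambda>x. enn2real ((\<integral>\<^sup>+h\<in>A. p h x \<partial>\<pi>) / (\<integral>\<^sup>+h. p h x \<partial>\<pi>)))"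
proof -
  let ?J = "joint_law H X K \<pi>" and ?E = "{z \<in> space (joint_law H X K \<pi>). fst z \<in> A}"
  let ?F = "vimage_algebra (space (joint_law H X K \<pi>)) snd X"
  define N where "N = (\<lambda>x. \<integral>\<^sup>+h\<in>A. p h x \<partial>\<pi>)"
  define Z where "Z = (\<lambda>x. \<integral>\<^sup>+h. p h x \<partial>\<pi>)"
  define f where "f = (\<lambda>x. enn2real (N x / Z x))"
  interpret P: prob_space \<pi> by (rule prior_on_simps[OF pi])
  interpret nu: sigma_finite_measure \<nu> by fact
  interpret PN: pair_sigma_finite \<pi> \<nu> ..
  note sp = prior_on_simps(2,3)[OF pi]
  note snu = nu(2) sets_eq_imp_space_eq[OF nu(2)]
  interpret J: prob_space ?J by (rule joint_law_simps[OF pi K])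
  have sJ: "sets ?J = sets (H \<Otimes>\<^sub>M X)" by (rule joint_law_simps[OF pi K])
  have spJ: "space ?J = space H \<times> space X" using sets_eq_imp_space_eq[OF sJ] by (simp add: space_pair_measure)
  have sPN: "sets (\<pi> \<Otimes>\<^sub>M \<nu>) = sets (H \<Otimes>\<^sub>M X)" by (rule sets_pair_measure_cong[OF sp(1) snu(1)])
  have pm[measurable]: "(\<lambda>(x, h). p h x) \<in> borel_measurable (X \<Otimes>\<^sub>M \<pi>)"
    unfolding measurable_cong_sets[OF sets_pair_measure_cong[OF refl sp(1)] refl] by measurable
  have A\<pi>[measurable]: "A \<in> sets \<pi>" using A sp by simp
  have Nm[measurable]: "N \<in> borel_measurable X" unfolding N_def by measurable
  have Zm[measurable]: "Z \<in> borel_measurable X" unfolding Z_def by measurable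
  have fm[measurable]: "f \<in> borel_measurable X" unfolding f_def by measurable
  have NZ: "N x \<le> Z x" for x unfolding N_def Z_def
    by (intro nn_integral_mono) (auto split: split_indicator)
  have q1: "N x / Z x \<le> 1" for x
  proof (cases "Z x = 0 \<or> Z x = \<top>")
    case True then show ?thesis using NZ[of x] by auto
  next
    case False
    then show ?thesis using NZ[of x]
      by (metis divide_right_mono_ennreal ennreal_divide_self top.not_eq_extremum)
  qed
  have ef: "ennreal (f x) = N x / Z x" for x
    unfolding f_def using q1[of x] by (simp add: ennreal_enn2real_if top_unique) (metis ennreal_one_less_top leD top_unique)
  have f01: "0 \<le> f x \<and> f x \<le> 1" for x
    using q1[of x] unfolding f_def by (auto intro: enn2real_leI)
  have J_int: "(\<integral>\<^sup>+z. g z \<partial>?J) = (\<integral>\<^sup>+x. \<integral>\<^sup>+h. p h x * g (h, x) \<partial>\<pi> \<partial>\<nu>)"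
    if g[measurable]: "g \<in> borel_measurable (H \<Otimes>\<^sub>M X)" for g
  proof -
    have "(\<integral>\<^sup>+z. g z \<partial>?J) = (\<integral>\<^sup>+h. \<integral>\<^sup>+x. g (h, x) \<partial>K h \<partial>\<pi>)"
      by (rule nn_integral_joint_law[OF pi K g])
    also have "\<dots> = (\<integral>\<^sup>+h. \<integral>\<^sup>+x. p h x * g (h, x) \<partial>\<nu> \<partial>\<pi>)"
    proof (rule nn_integral_cong)
      fix h assume "h \<in> space \<pi>"
      then have h: "h \<in> space H" using sp by simp
      have m: "p h \<in> borel_measurable \<nu>" "(\<lambda>x. g (h, x)) \<in> borel_measurable \<nu>"
        unfolding measurable_cong_sets[OF nu(2) refl] using h by measurable
      show "(\<integral>\<^sup>+x. g (h, x) \<partial>K h) = (\<integral>\<^sup>+x. p h x * g (h, x) \<partial>\<nu>)"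
        unfolding dens[OF h] by (rule nn_integral_density[OF m])
    qed
    also have "\<dots> = (\<integral>\<^sup>+x. \<integral>\<^sup>+h. p h x * g (h, x) \<partial>\<pi> \<partial>\<nu>)"
    proof (rule PN.Fubini'[symmetric])
      show "(\<lambda>(h, x). p h x * g (h, x)) \<in> borel_measurable (\<pi> \<Otimes>\<^sub>M \<nu>)"
        unfolding measurable_cong_sets[OF sPN refl] by measurable
    qed
    finally show ?thesis .
  qed
  have "(\<integral>\<^sup>+x. Z x \<partial>\<nu>) = (\<integral>\<^sup>+z. 1 \<partial>?J)"
    by (subst J_int) (auto simp: Z_def)
  also have "\<dots> = 1" by (simp add: J.emeasure_space_1)
  finally have "(\<integral>\<^sup>+x. Z x \<partial>\<nu>) \<noteq> \<infinity>" by simp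
  then have Zfin: "AE x in \<nu>. Z x \<noteq> \<infinity>"
    using Zm by (intro nn_integral_PInf_AE) (auto simp: measurable_cong_sets[OF nu(2) refl])
  have sndJ: "snd \<in> measurable ?J X" unfolding measurable_cong_sets[OF sJ refl] by measurable
  have setsF: "sets ?F = {snd -` B \<inter> space ?J | B. B \<in> sets X}"
    by (rule sets_vimage_algebra2) (auto simp: spJ)
  have sub: "subalgebra ?J ?F"
    unfolding subalgebra_def setsF using measurable_sets[OF sndJ] by auto
  interpret C: finite_measure_subalgebra ?J ?F by unfold_locales (rule sub)
  have snd_F: "snd \<in> measurable ?F X" by (rule measurable_vimage_algebra1) (auto simp: spJ)
  have E: "?E \<in> sets ?J"
  proof -
    have "?E = A \<times> space X" using sets.sets_into_space[OF A] by (auto simp: spJ)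
    then show ?thesis by (simp add: sJ)
  qed
  have fJ: "(\<lambda>z. f (snd z)) \<in> borel_measurable ?J" using fm sndJ by (rule measurable_compose[rotated])
  have "AE z in ?J. real_cond_exp ?J ?F (indicator ?E) z = f (snd z)"
  proof (rule C.real_cond_exp_charact)
    show "integrable ?J (indicator ?E :: _ \<Rightarrow> real)" using E by (simp add: J.emeasure_eq_measure)
    show "integrable ?J (\<lambda>z. f (snd z))"
      using fJ by (intro J.integrable_const_bound[where B=1]) (auto simp: f01)
    show "(\<lambda>z. f (snd z)) \<in> borel_measurable ?F" using measurable_compose[OF snd_F fm] .
    fix S assume "S \<in> sets ?F"
    then obtain B where B[measurable]: "B \<in> sets X" and S: "S = snd -` B \<inter> space ?J"
      unfolding setsF by blast
    have SJ: "S \<in> sets ?J" using B sndJ S by (simp add: measurable_sets)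
    have "(\<integral>\<^sup>+z. ennreal (indicator S z * indicator ?E z) \<partial>?J) = (\<integral>\<^sup>+z. indicator B (snd z) * indicator A (fst z) \<partial>?J)"
      by (intro nn_integral_cong) (auto simp: S split: split_indicator)
    also have "\<dots> = (\<integral>\<^sup>+x. N x * indicator B x \<partial>\<nu>)"
    proof (subst J_int)
      show "(\<integral>\<^sup>+x. \<integral>\<^sup>+h. p h x * (indicator B (snd (h, x)) * indicator A (fst (h, x))) \<partial>\<pi> \<partial>\<nu>) = (\<integral>\<^sup>+x. N x * indicator B x \<partial>\<nu>)"
        unfolding N_def by (intro nn_integral_cong) (auto split: split_indicator)
    qed measurable
    also have "\<dots> = (\<integral>\<^sup>+x. Z x * (ennreal (f x) * indicator B x) \<partial>\<nu>)"
    proof (rule nn_integral_cong_AE)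
      show "AE x in \<nu>. N x * indicator B x = Z x * (ennreal (f x) * indicator B x)"
        using Zfin
      proof eventually_elim
        fix x assume z: "Z x \<noteq> \<infinity>"
        have "Z x * (N x / Z x) = N x"
        proof (cases "Z x = 0")
          case True then show ?thesis using NZ[of x] by simp
        next
          case False then show ?thesis using z
            by (metis ennreal_times_divide infinity_ennreal_def mult.commute ennreal_mult_divide_eq)
        qed
        then show "N x * indicator B x = Z x * (ennreal (f x) * indicator B x)"
          by (simp add: ef mult.assoc[symmetric])
      qed
    qed
    also have "\<dots> = (\<integral>\<^sup>+x. \<integral>\<^sup>+h. p h x * (ennreal (f x) * indicator B x) \<partial>\<pi> \<partial>\<nu>)"
    proof (rule nn_integral_cong)
      fix x assume "x \<in> space \<nu>"
      then have x: "x \<in> space X" using snu by simp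
      have "(\<lambda>h. p h x) \<in> borel_measurable \<pi>" using pm x by measurable
      then show "Z x * (ennreal (f x) * indicator B x) = (\<integral>\<^sup>+h. p h x * (ennreal (f x) * indicator B x) \<partial>\<pi>)"
        unfolding Z_def by (simp add: nn_integral_multc)
    qed
    also have "\<dots> = (\<integral>\<^sup>+z. ennreal (f (snd z)) * indicator B (snd z) \<partial>?J)"
      by (subst J_int) auto
    also have "\<dots> = (\<integral>\<^sup>+z. ennreal (indicator S z * f (snd z)) \<partial>?J)"
      by (intro nn_integral_cong) (auto simp: S split: split_indicator)
    finally have eq: "(\<integral>\<^sup>+z. ennreal (indicator S z * indicator ?E z) \<partial>?J) = (\<integral>\<^sup>+z. ennreal (indicator S z * f (snd z)) \<partial>?J)" .
    show "set_lebesgue_integral ?J S (indicator ?E) = set_lebesgue_integral ?J S (\<lambda>z. f (snd z))"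
      unfolding set_lebesgue_integral_def real_scaleR_def
      using SJ E fJ f01 eq by (subst (1 2) integral_eq_nn_integral) auto
  qed
  then show ?thesis
    unfolding is_posterior_def is_cond_prob_def using fm f01
    by (simp add: f_def N_def Z_def)
qed
text \<open>
  Random variables \<open>h\<close> (the unknown) and \<open>x\<close> (the data) on a probability space \<open>M\<close>, which may
  carry further random objects, with the joint law given by prior and likelihood.
\<close>

definition system_on ::
    "'w measure \<Rightarrow> 'h measure \<Rightarrow> 'x measure \<Rightarrow> ('h \<Rightarrow> 'x measure) \<Rightarrow> 'h measure \<Rightarrow>
     ('w \<Rightarrow> 'h) \<Rightarrow> ('w \<Rightarrow> 'x) \<Rightarrow> bool" where
  "system_on M H X K \<pi> h x \<longleftrightarrow>
     prob_space M \<and> h \<in> measurable M H \<and> x \<in> measurable M X \<and>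
     distr M (H \<Otimes>\<^sub>M X) (\<lambda>\<omega>. (h \<omega>, x \<omega>)) = joint_law H X K \<pi>"

text \<open>
  Identical systems share \<open>H\<close>, \<open>X\<close>, \<open>K\<close> (and the hypotheses); the prior on
  \<open>(h\<^sub>1, \<dots>, h\<^sub>N)\<close> may have arbitrary, possibly different, marginals \<open>\<pi> n\<close>.
\<close>

definition independent_systems_on ::
    "'w measure \<Rightarrow> 'h measure \<Rightarrow> 'x measure \<Rightarrow> ('h \<Rightarrow> 'x measure) \<Rightarrow> nat \<Rightarrow> (nat \<Rightarrow> 'h measure) \<Rightarrow>
     (nat \<Rightarrow> 'w \<Rightarrow> 'h) \<Rightarrow> (nat \<Rightarrow> 'w \<Rightarrow> 'x) \<Rightarrow> bool" where
  "independent_systems_on M H X K N \<pi> h x \<longleftrightarrow>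
     (\<forall>n\<in>{1..N}. prior_on H (\<pi> n) \<and> system_on M H X K (\<pi> n) (h n) (x n)) \<and>
     prob_space.indep_vars M (\<lambda>_. H \<Otimes>\<^sub>M X) (\<lambda>n \<omega>. (h n \<omega>, x n \<omega>)) {1..N}"

text \<open>
  Sequential data \<open>x\<^sub>1, x\<^sub>2, \<dots>\<close>: a data sequence is a function on the index set \<open>{1..}\<close>, and
  \<open>(x\<^sub>1, \<dots>, x\<^sub>k)\<close> is its restriction to \<open>{1..k}\<close>. Given \<open>h\<close> the \<open>x\<^sub>k\<close> are independent with
  laws \<open>L k h\<close>.
\<close>

definition seq_lik :: "(nat \<Rightarrow> 'h \<Rightarrow> 'y measure) \<Rightarrow> 'h \<Rightarrow> (nat \<Rightarrow> 'y) measure" where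
  "seq_lik L h = PiM {1..} (\<lambda>i. L i h)"

definition is_seq_posterior ::
    "'h measure \<Rightarrow> (nat \<Rightarrow> 'y measure) \<Rightarrow> (nat \<Rightarrow> 'h \<Rightarrow> 'y measure) \<Rightarrow> 'h measure \<Rightarrow> 'h set \<Rightarrow>
     nat \<Rightarrow> ((nat \<Rightarrow> 'y) \<Rightarrow> real) \<Rightarrow> bool" where
  "is_seq_posterior H Y L \<pi> A k f \<longleftrightarrow>
     (let J = joint_law H (PiM {1..} Y) (seq_lik L) \<pi> in
      is_cond_prob J {z \<in> space J. fst z \<in> A} (PiM {1..k} Y) (\<lambda>z. restrict (snd z) {1..k}) f)"

definition quits_at ::
    "(nat \<Rightarrow> (nat \<Rightarrow> 'y) \<Rightarrow> real) \<Rightarrow> (nat \<Rightarrow> 'y) \<Rightarrow> (nat \<Rightarrow> real) \<Rightarrow> nat \<Rightarrow> bool" where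
  "quits_at q x u k \<longleftrightarrow>
     u k < q k (restrict x {1..k}) \<and> (\<forall>j<k. \<not> u j < q j (restrict x {1..j}))"

text \<open>
  \<open>post k\<close> is the posterior \<open>P(h \<in> H\<^sub>1 | x\<^sub>1, \<dots>, x\<^sub>k)\<close>. The last clause is required for every data
  sequence, not just almost every one: the law of the data for one particular \<open>h\<close> may charge
  null sets of the marginal law.
\<close>

definition analysis_plan ::
    "(nat \<Rightarrow> 'y measure) \<Rightarrow> (nat \<Rightarrow> (nat \<Rightarrow> 'y) \<Rightarrow> real) \<Rightarrow> real \<Rightarrow> (nat \<Rightarrow> (nat \<Rightarrow> 'y) \<Rightarrow> real) \<Rightarrow> bool" where
  "analysis_plan Y post \<eta> q \<longleftrightarrow>
     (\<forall>k. q k \<in> borel_measurable (PiM {1..k} Y)) \<and>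
     (\<forall>k. \<forall>y\<in>space (PiM {1..k} Y). 0 \<le> q k y \<and> q k y \<le> 1) \<and>
     (\<forall>k. \<forall>x\<in>space (PiM {1..} Y). \<forall>u. (\<forall>j. u j \<in> {0<..<1}) \<longrightarrow> quits_at q x u k \<longrightarrow>
        post k (restrict x {1..k}) \<ge> \<eta>)"

definition conclude_prob ::
    "(nat \<Rightarrow> 'h \<Rightarrow> 'y measure) \<Rightarrow> (nat \<Rightarrow> (nat \<Rightarrow> 'y) \<Rightarrow> real) \<Rightarrow> nat \<Rightarrow> 'h \<Rightarrow> real" where
  "conclude_prob L q k h =
     (let P = seq_lik L h \<Otimes>\<^sub>M PiM UNIV (\<lambda>_::nat. uniform_measure lborel {0<..<1::real}) in
      measure P {(x, u) \<in> space P. \<exists>j\<le>k. quits_at q x u j})"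

end

theory Submission
  imports Defs
begin

text \<open>
  The work lies in reading a conditional probability \<open>f = P(E | Y)\<close> as a density: on the
  event \<open>E\<close>, the law of \<open>Y\<close> has density \<open>f\<close> with respect to the unrestricted law of \<open>Y\<close>
  (\<open>is_cond_prob_iff_density\<close>). It follows that \<open>1\<^sub>E\<close> can be exchanged for \<open>f(Y)\<close> under integrals
  against functions of \<open>Y\<close> (\<open>is_cond_prob_nn_integral\<close>), and that posteriors can be used on any
  space carrying the system (\<open>is_cond_prob_posterior\<close>).

  Complementarity and inclusion say that conditional probability is additive and monotone. Intention
  holds because a stopping event \<open>S\<close> that is conditionally independent of \<open>h\<close> given the data
  cancels from the posterior: for every event \<open>E\<close> about \<open>h\<close>, \<open>P(E, S | x)\<close> factors
  into \<open>P(E | x) P(S | x)\<close> (\<open>is_cond_prob_given_irrelevant_event\<close>).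

  Conjunction, disjunction and multiplicity are three uses of one product formula for independent
  systems, \<open>P(\<forall>n. h\<^sub>n \<in> A\<^sub>n | x\<^sub>1, \<dots>, x\<^sub>N) = \<Prod>\<^sub>n P(h\<^sub>n \<in> A\<^sub>n | x\<^sub>n)\<close> (\<open>is_cond_prob_prod\<close>). With all
  \<open>A\<^sub>n = H\<^sub>1\<close> it gives \<open>\<eta>\<^sup>N < \<eta>\<close>; with all \<open>A\<^sub>n\<close> equal to the complement it gives
  \<open>1 - (1 - \<eta>)\<^sup>N > \<eta>\<close>; with \<open>A\<^sub>1 = H\<^sub>1\<close> and the other \<open>A\<^sub>n\<close> trivial the product has only one
  factor left.

  For sequential optimality, the optimal plan quits with probability \<open>1\<close> as soon as the posterior
  reaches \<open>\<eta>\<close>. A competing plan can only quit when the posterior has reached \<open>\<eta>\<close>, hence never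
  before this one, for each data sequence separately. No averaging over the prior takes place, and
  that is why the comparison holds for each single true value of \<open>h\<close>
  (\<open>conclude_prob_le_threshold_plan\<close>).
\<close>

section \<open>Conditional probabilities as densities\<close>

lemma (in prob_space) finite_measure_subalgebra_vimage:
  assumes Y: "Y \<in> measurable M S"
  shows "finite_measure_subalgebra M (vimage_algebra (space M) Y S)"
proof -
  have "subalgebra M (vimage_algebra (space M) Y S)"
    unfolding subalgebra_def using Y
    by (auto simp: sets_vimage_algebra2 measurable_def)
  then show ?thesis by unfold_locales
qed

text \<open>
  The defining property of the conditional expectation of \<open>1\<^sub>E\<close> speaks of integrals over preimages
  \<open>Y -` B\<close>, hence of the law of \<open>Y\<close> on \<open>E\<close>. Read in this way, \<open>f\<close> is a Radon-Nikodym derivative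
  on \<open>S\<close> and the sub-\<open>\<sigma>\<close>-algebra generated by \<open>Y\<close> disappears, so that equality of two measures
  can be checked on a generator.
\<close>

lemma (in prob_space) is_cond_prob_iff_density:
  assumes E[measurable]: "E \<in> sets M" and Y[measurable]: "Y \<in> measurable M S"
  shows "is_cond_prob M E S Y f \<longleftrightarrow>
    f \<in> borel_measurable S \<and> (\<forall>y\<in>space S. 0 \<le> f y \<and> f y \<le> 1) \<and>
    distr (density M (indicator E)) S Y = density (distr M S Y) (\<lambda>y. ennreal (f y))"
    (is "_ \<longleftrightarrow> _ \<and> _ \<and> ?P = ?Q")
proof (cases "f \<in> borel_measurable S \<and> (\<forall>y\<in>space S. 0 \<le> f y \<and> f y \<le> 1)")
  case False
  then show ?thesis by (auto simp: is_cond_prob_def)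
next
  case True
  then have fm[measurable]: "f \<in> borel_measurable S" by simp
  have f01: "0 \<le> f (Y \<omega>)" "f (Y \<omega>) \<le> 1" if "\<omega> \<in> space M" for \<omega>
    using True measurable_space[OF Y that] by auto
  let ?F = "vimage_algebra (space M) Y S"
  let ?l = "\<lambda>A. set_lebesgue_integral M A (indicator E :: _ \<Rightarrow> real)"
  let ?r = "\<lambda>A. set_lebesgue_integral M A (\<lambda>\<omega>. f (Y \<omega>))"
  interpret F: finite_measure_subalgebra M ?F
    by (rule finite_measure_subalgebra_vimage[OF Y])
  have setsF: "sets ?F = {Y -` B \<inter> space M | B. B \<in> sets S}"
    using measurable_space[OF Y] by (intro sets_vimage_algebra2) auto
  have fF: "(\<lambda>\<omega>. f (Y \<omega>)) \<in> borel_measurable ?F"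
    by (rule measurable_compose[OF measurable_vimage_algebra1 fm])
      (use measurable_space[OF Y] in auto)
  have intE: "integrable M (indicator E :: _ \<Rightarrow> real)"
    by (simp add: emeasure_eq_measure)
  have intf: "integrable M (\<lambda>\<omega>. f (Y \<omega>))"
    by (intro integrable_const_bound[where B=1]) (auto simp: f01)
  have P: "emeasure ?P B = ennreal (?l (Y -` B \<inter> space M))" if [measurable]: "B \<in> sets S" for B
  proof -
    have "emeasure ?P B = (\<integral>\<^sup>+\<omega>. indicator E \<omega> * indicator (Y -` B \<inter> space M) \<omega> \<partial>M)"
      by (simp add: emeasure_distr emeasure_density)
    also have "\<dots> = (\<integral>\<^sup>+\<omega>. ennreal (indicator (Y -` B \<inter> space M) \<omega> *\<^sub>R indicator E \<omega>) \<partial>M)"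
      by (intro nn_integral_cong) (auto split: split_indicator)
    also have "\<dots> = ennreal (?l (Y -` B \<inter> space M))"
      unfolding set_lebesgue_integral_def
      by (intro nn_integral_eq_integral integrable_mult_indicator intE) auto
    finally show ?thesis .
  qed
  have Q: "emeasure ?Q B = ennreal (?r (Y -` B \<inter> space M))" if [measurable]: "B \<in> sets S" for B
  proof -
    have "emeasure ?Q B = (\<integral>\<^sup>+\<omega>. ennreal (f (Y \<omega>)) * indicator B (Y \<omega>) \<partial>M)"
      by (simp add: emeasure_density nn_integral_distr)
    also have "\<dots> = (\<integral>\<^sup>+\<omega>. ennreal (indicator (Y -` B \<inter> space M) \<omega> *\<^sub>R f (Y \<omega>)) \<partial>M)"
      by (intro nn_integral_cong) (auto split: split_indicator)
    also have "\<dots> = ennreal (?r (Y -` B \<inter> space M))"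
      unfolding set_lebesgue_integral_def
      by (intro nn_integral_eq_integral integrable_mult_indicator intf) (auto simp: f01)
    finally show ?thesis .
  qed
  have nonneg: "0 \<le> ?l A" "0 \<le> ?r A" for A
    unfolding set_lebesgue_integral_def by (auto intro!: integral_nonneg_AE simp: f01)
  have "?P = ?Q \<longleftrightarrow> (\<forall>B\<in>sets S. emeasure ?P B = emeasure ?Q B)"
    by (auto intro: measure_eqI)
  also have "\<dots> \<longleftrightarrow> (\<forall>A\<in>sets ?F. ?l A = ?r A)"
    by (auto simp: P Q nonneg setsF)
  also have "\<dots> \<longleftrightarrow> (AE \<omega> in M. real_cond_exp M ?F (indicator E) \<omega> = f (Y \<omega>))"
  proof
    assume "\<forall>A\<in>sets ?F. ?l A = ?r A"
    then show "AE \<omega> in M. real_cond_exp M ?F (indicator E) \<omega> = f (Y \<omega>)"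
      by (intro F.real_cond_exp_charact intE intf fF) auto
  next
    assume ae: "AE \<omega> in M. real_cond_exp M ?F (indicator E) \<omega> = f (Y \<omega>)"
    show "\<forall>A\<in>sets ?F. ?l A = ?r A"
    proof
      fix A assume A: "A \<in> sets ?F"
      then have [measurable]: "A \<in> sets M" using F.subalg by (auto simp: subalgebra_def)
      have "?l A = set_lebesgue_integral M A (real_cond_exp M ?F (indicator E))"
        by (rule F.real_cond_exp_intA[OF intE A])
      also have "\<dots> = ?r A"
        using ae by (intro set_lebesgue_integral_cong_AE) auto
      finally show "?l A = ?r A" .
    qed
  qed
  finally show ?thesis using True by (simp add: is_cond_prob_def)
qed

text \<open>
  The replacement rule for all later computations: in front of a function of \<open>Y\<close>, the indicator
  of \<open>E\<close> may be exchanged for the conditional probability. Nonnegative integrals make it free of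
  integrability conditions.
\<close>

lemma (in prob_space) is_cond_prob_nn_integral:
  assumes f: "is_cond_prob M E S Y f"
    and E[measurable]: "E \<in> sets M" and Y[measurable]: "Y \<in> measurable M S"
    and g[measurable]: "g \<in> borel_measurable S"
  shows "(\<integral>\<^sup>+\<omega>. indicator E \<omega> * g (Y \<omega>) \<partial>M) = (\<integral>\<^sup>+\<omega>. ennreal (f (Y \<omega>)) * g (Y \<omega>) \<partial>M)"
proof -
  have [measurable]: "f \<in> borel_measurable S" using f by (simp add: is_cond_prob_def)
  have "(\<integral>\<^sup>+\<omega>. indicator E \<omega> * g (Y \<omega>) \<partial>M) = (\<integral>\<^sup>+y. g y \<partial>distr (density M (indicator E)) S Y)"
    by (simp add: nn_integral_distr nn_integral_density)
  also have "\<dots> = (\<integral>\<^sup>+y. g y \<partial>density (distr M S Y) (\<lambda>y. ennreal (f y)))"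
    using f is_cond_prob_iff_density[OF E Y] by simp
  also have "\<dots> = (\<integral>\<^sup>+\<omega>. ennreal (f (Y \<omega>)) * g (Y \<omega>) \<partial>M)"
    by (simp add: nn_integral_distr nn_integral_density)
  finally show ?thesis .
qed

lemma (in prob_space) is_cond_probI:
  assumes E[measurable]: "E \<in> sets M" and Y[measurable]: "Y \<in> measurable M S"
    and f[measurable]: "f \<in> borel_measurable S" and f01: "\<And>y. y \<in> space S \<Longrightarrow> 0 \<le> f y \<and> f y \<le> 1"
    and eq: "\<And>B. B \<in> sets S \<Longrightarrow>
      (\<integral>\<^sup>+\<omega>. indicator E \<omega> * indicator B (Y \<omega>) \<partial>M)
        = (\<integral>\<^sup>+\<omega>. ennreal (f (Y \<omega>)) * indicator B (Y \<omega>) \<partial>M)"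
  shows "is_cond_prob M E S Y f"
proof -
  have "distr (density M (indicator E)) S Y = density (distr M S Y) (\<lambda>y. ennreal (f y))"
  proof (rule measure_eqI)
    fix B assume "B \<in> sets (distr (density M (indicator E)) S Y)"
    then have B[measurable]: "B \<in> sets S" by simp
    have "emeasure (distr (density M (indicator E)) S Y) B
        = (\<integral>\<^sup>+\<omega>. indicator E \<omega> * indicator B (Y \<omega>) \<partial>M)"
      by (auto simp: emeasure_distr emeasure_density intro!: nn_integral_cong split: split_indicator)
    also have "\<dots> = emeasure (density (distr M S Y) (\<lambda>y. ennreal (f y))) B"
      by (simp add: eq[OF B] emeasure_density nn_integral_distr)
    finally show "emeasure (distr (density M (indicator E)) S Y) B
        = emeasure (density (distr M S Y) (\<lambda>y. ennreal (f y))) B" .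
  qed simp
  then show ?thesis using f f01 by (simp add: is_cond_prob_iff_density[OF E Y])
qed

lemma is_cond_prob_unique:
  assumes "is_cond_prob M E S Y f" "is_cond_prob M E S Y g"
  shows "AE \<omega> in M. f (Y \<omega>) = g (Y \<omega>)"
  using assms unfolding is_cond_prob_def by (auto elim: AE_mp)

lemma (in prob_space) is_cond_prob_mono:
  assumes f: "is_cond_prob M E S Y f" and g: "is_cond_prob M G S Y g"
    and E[measurable]: "E \<in> sets M" and G[measurable]: "G \<in> sets M" and EG: "E \<subseteq> G"
    and Y: "Y \<in> measurable M S"
  shows "AE \<omega> in M. f (Y \<omega>) \<le> g (Y \<omega>)"
proof -
  let ?F = "vimage_algebra (space M) Y S"
  interpret F: finite_measure_subalgebra M ?F
    by (rule finite_measure_subalgebra_vimage[OF Y])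
  have "AE \<omega> in M. real_cond_exp M ?F (indicator E) \<omega> \<le> real_cond_exp M ?F (indicator G) \<omega>"
    using EG by (intro F.real_cond_exp_mono) (auto simp: emeasure_eq_measure split: split_indicator)
  moreover have "AE \<omega> in M. real_cond_exp M ?F (indicator E) \<omega> = f (Y \<omega>)"
    "AE \<omega> in M. real_cond_exp M ?F (indicator G) \<omega> = g (Y \<omega>)"
    using f g by (auto simp: is_cond_prob_def)
  ultimately show ?thesis by eventually_elim simp
qed

lemma (in prob_space) is_cond_prob_compl:
  assumes f: "is_cond_prob M E S Y f"
    and E[measurable]: "E \<in> sets M" and Y: "Y \<in> measurable M S"
  shows "is_cond_prob M (space M - E) S Y (\<lambda>y. 1 - f y)"
proof -
  let ?F = "vimage_algebra (space M) Y S"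
  interpret F: finite_measure_subalgebra M ?F
    by (rule finite_measure_subalgebra_vimage[OF Y])
  have "AE \<omega> in M. real_cond_exp M ?F (indicator (space M - E)) \<omega>
      = real_cond_exp M ?F (\<lambda>\<omega>. 1 - indicator E \<omega>) \<omega>"
    by (intro F.real_cond_exp_cong AE_I2) (auto split: split_indicator)
  moreover have "AE \<omega> in M. real_cond_exp M ?F (\<lambda>\<omega>. 1 - indicator E \<omega>) \<omega>
      = real_cond_exp M ?F (\<lambda>_. 1) \<omega> - real_cond_exp M ?F (indicator E) \<omega>"
    by (intro F.real_cond_exp_diff) (auto simp: emeasure_eq_measure)
  moreover have "AE \<omega> in M. real_cond_exp M ?F (\<lambda>_. 1) \<omega> = 1"
    by (intro F.real_cond_exp_F_meas) auto
  moreover have "AE \<omega> in M. real_cond_exp M ?F (indicator E) \<omega> = f (Y \<omega>)"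
    using f by (simp add: is_cond_prob_def)
  ultimately have
    "AE \<omega> in M. real_cond_exp M ?F (indicator (space M - E)) \<omega> = 1 - f (Y \<omega>)"
    by eventually_elim simp
  then show ?thesis using f by (auto simp: is_cond_prob_def)
qed

section \<open>Conditioning on an irrelevant event, and independent events\<close>

text \<open>
  Write \<open>F = fS (True, \<cdot>)\<close>. For measurable \<open>B\<close>, replacing \<open>1\<^sub>S\<close> by \<open>g = s\<close> given \<open>(x, h)\<close>, then
  \<open>1\<^sub>E\<close> by \<open>f\<close> given \<open>x\<close>, and at last \<open>s\<close> by \<open>1\<^sub>S\<close> again given \<open>x\<close>, where \<open>E\<close> is the event
  \<open>h \<in> A\<close>, gives
  \<open>E[F(x) 1\<^sub>S 1\<^sub>B(x)] = E[1\<^sub>E 1\<^sub>S 1\<^sub>B(x)] = E[1\<^sub>E s(x) 1\<^sub>B(x)] = E[f(x) s(x) 1\<^sub>B(x)] = E[f(x) 1\<^sub>S 1\<^sub>B(x)]\<close>.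
  Taking for \<open>B\<close> the sets where \<open>F > f\<close> and where \<open>f > F\<close> shows that both are null on \<open>S\<close>.
\<close>

lemma (in prob_space) is_cond_prob_given_irrelevant_event:
  assumes h[measurable]: "h \<in> measurable M H" and x[measurable]: "x \<in> measurable M X"
    and S[measurable]: "S \<in> sets M" and A[measurable]: "A \<in> sets H"
    and s: "is_cond_prob M S X x s"
    and g: "is_cond_prob M S (X \<Otimes>\<^sub>M H) (\<lambda>\<omega>. (x \<omega>, h \<omega>)) g"
    and gs: "AE \<omega> in M. g (x \<omega>, h \<omega>) = s (x \<omega>)"
    and f: "is_cond_prob M {\<omega> \<in> space M. h \<omega> \<in> A} X x f"
    and fS: "is_cond_prob M {\<omega> \<in> space M. h \<omega> \<in> A} (count_space UNIV \<Otimes>\<^sub>M X)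
      (\<lambda>\<omega>. (\<omega> \<in> S, x \<omega>)) fS"
  shows "AE \<omega> in M. \<omega> \<in> S \<longrightarrow> fS (True, x \<omega>) = f (x \<omega>)"
proof -
  let ?E = "{\<omega> \<in> space M. h \<omega> \<in> A}"
  have [measurable]: "f \<in> borel_measurable X" "s \<in> borel_measurable X"
      "fS \<in> borel_measurable (count_space UNIV \<Otimes>\<^sub>M X)"
    and f01: "\<And>y. y \<in> space X \<Longrightarrow> 0 \<le> f y \<and> f y \<le> 1"
    and fS01: "\<And>z. z \<in> space (count_space UNIV \<Otimes>\<^sub>M X) \<Longrightarrow> 0 \<le> fS z \<and> fS z \<le> 1"
    using s f fS by (auto simp: is_cond_prob_def)
  have val: "h \<omega> \<in> space H" "x \<omega> \<in> space X" if "\<omega> \<in> space M" for \<omega>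
    using that by (auto intro: measurable_space)
  define F where "F y = fS (True, y)" for y
  have [measurable]: "F \<in> borel_measurable X" unfolding F_def by measurable
  have F01: "0 \<le> F y \<and> F y \<le> 1" if "y \<in> space X" for y
    unfolding F_def using fS01[of "(True, y)"] that by (simp add: space_pair_measure)
  have E[measurable]: "?E \<in> sets M" by measurable
  have key: "(\<integral>\<^sup>+\<omega>. ennreal (F (x \<omega>)) * (indicator S \<omega> * indicator B (x \<omega>)) \<partial>M)
      = (\<integral>\<^sup>+\<omega>. ennreal (f (x \<omega>)) * (indicator S \<omega> * indicator B (x \<omega>)) \<partial>M)"
    if B[measurable]: "B \<in> sets X" for B
  proof -
    let ?T = "indicator ({True} \<times> B) :: bool \<times> 'c \<Rightarrow> ennreal"
    have "(\<integral>\<^sup>+\<omega>. ennreal (F (x \<omega>)) * (indicator S \<omega> * indicator B (x \<omega>)) \<partial>M)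
        = (\<integral>\<^sup>+\<omega>. ennreal (fS (\<omega> \<in> S, x \<omega>)) * ?T (\<omega> \<in> S, x \<omega>) \<partial>M)"
      by (intro nn_integral_cong) (auto simp: F_def split: split_indicator)
    also have "\<dots> = (\<integral>\<^sup>+\<omega>. indicator ?E \<omega> * ?T (\<omega> \<in> S, x \<omega>) \<partial>M)"
      by (rule is_cond_prob_nn_integral[OF fS E, symmetric]) measurable
    also have "\<dots> = (\<integral>\<^sup>+\<omega>. indicator S \<omega> * (indicator A (h \<omega>) * indicator B (x \<omega>)) \<partial>M)"
      by (intro nn_integral_cong) (auto split: split_indicator)
    also have "\<dots> = (\<integral>\<^sup>+\<omega>. ennreal (g (x \<omega>, h \<omega>)) * (indicator A (h \<omega>) * indicator B (x \<omega>)) \<partial>M)"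
      using is_cond_prob_nn_integral[OF g S, of "\<lambda>z. indicator A (snd z) * indicator B (fst z)"]
      by simp
    also have "\<dots> = (\<integral>\<^sup>+\<omega>. indicator ?E \<omega> * (ennreal (s (x \<omega>)) * indicator B (x \<omega>)) \<partial>M)"
      using gs by (intro nn_integral_cong_AE, elim AE_mp) (auto split: split_indicator)
    also have "\<dots> = (\<integral>\<^sup>+\<omega>. ennreal (f (x \<omega>)) * (ennreal (s (x \<omega>)) * indicator B (x \<omega>)) \<partial>M)"
      by (rule is_cond_prob_nn_integral[OF f E x]) measurable
    also have "\<dots> = (\<integral>\<^sup>+\<omega>. ennreal (s (x \<omega>)) * (ennreal (f (x \<omega>)) * indicator B (x \<omega>)) \<partial>M)"
      by (simp add: ac_simps)
    also have "\<dots> = (\<integral>\<^sup>+\<omega>. indicator S \<omega> * (ennreal (f (x \<omega>)) * indicator B (x \<omega>)) \<partial>M)"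
      by (rule is_cond_prob_nn_integral[OF s S x, symmetric]) measurable
    finally show ?thesis by (simp add: ac_simps)
  qed
  have null: "AE \<omega> in M. \<not> (\<omega> \<in> S \<and> F (x \<omega>) \<noteq> f (x \<omega>))"
  proof -
    have le: "AE \<omega> in M. \<omega> \<in> S \<longrightarrow> \<not> v (x \<omega>) < w (x \<omega>)"
      if [measurable]: "v \<in> borel_measurable X" "w \<in> borel_measurable X"
        and v01: "\<And>y. y \<in> space X \<Longrightarrow> 0 \<le> v y \<and> v y \<le> 1"
        and eq: "\<And>B. B \<in> sets X \<Longrightarrow>
          (\<integral>\<^sup>+\<omega>. ennreal (w (x \<omega>)) * (indicator S \<omega> * indicator B (x \<omega>)) \<partial>M)
          = (\<integral>\<^sup>+\<omega>. ennreal (v (x \<omega>)) * (indicator S \<omega> * indicator B (x \<omega>)) \<partial>M)"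
      for v w :: "'c \<Rightarrow> real"
    proof -
      let ?B = "{y \<in> space X. v y < w y}"
      let ?v = "\<lambda>\<omega>. ennreal (v (x \<omega>)) * (indicator S \<omega> * indicator ?B (x \<omega>))"
      let ?w = "\<lambda>\<omega>. ennreal (w (x \<omega>)) * (indicator S \<omega> * indicator ?B (x \<omega>))"
      have "(\<integral>\<^sup>+\<omega>. ?v \<omega> \<partial>M) \<le> (\<integral>\<^sup>+\<omega>. 1 \<partial>M)"
        using v01 val by (intro nn_integral_mono) (auto split: split_indicator)
      then have fin: "(\<integral>\<^sup>+\<omega>. ?v \<omega> \<partial>M) \<noteq> \<infinity>"
        by (auto simp: emeasure_space_1 top_unique)
      have "(\<integral>\<^sup>+\<omega>. ?w \<omega> - ?v \<omega> \<partial>M) = (\<integral>\<^sup>+\<omega>. ?w \<omega> \<partial>M) - (\<integral>\<^sup>+\<omega>. ?v \<omega> \<partial>M)"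
        using fin by (intro nn_integral_diff) (auto intro!: AE_I2 ennreal_leI split: split_indicator)
      also have "\<dots> = 0" using fin by (subst eq) auto
      finally have "AE \<omega> in M. ?w \<omega> - ?v \<omega> = 0" by (subst (asm) nn_integral_0_iff_AE) auto
      then show ?thesis
      proof (rule AE_mp, intro AE_I2 impI notI)
        fix \<omega> assume *: "\<omega> \<in> space M" "?w \<omega> - ?v \<omega> = 0" "\<omega> \<in> S" "v (x \<omega>) < w (x \<omega>)"
        then have "ennreal (w (x \<omega>)) \<le> ennreal (v (x \<omega>))"
          using val by (simp add: diff_eq_0_iff_ennreal)
        then show False using * v01[OF val(2)[OF *(1)]] by (simp add: ennreal_le_iff2)
      qed
    qed
    show ?thesis
      using le[OF _ _ f01 key] le[OF _ _ F01 key[symmetric]] by (auto elim!: AE_mp)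
  qed
  then show ?thesis by (auto simp: F_def elim!: AE_mp)
qed

text \<open>
  The law of the data on the event that all \<open>h\<^sub>i \<in> A\<^sub>i\<close>, and the measure with density \<open>\<Prod>\<^sub>i f\<^sub>i\<close> with
  respect to the law of the data, are finite measures on a finite product space. On a box they both
  factor by independence, the first into \<open>P(h\<^sub>i \<in> A\<^sub>i, x\<^sub>i \<in> B\<^sub>i)\<close> and the second into
  \<open>E[f\<^sub>i(x\<^sub>i) 1(x\<^sub>i \<in> B\<^sub>i)]\<close>; these factors agree, and boxes determine the measures. The sets \<open>A\<^sub>i\<close> may
  differ, so the same lemma serves for the conjunction, for its complement, and for a
  statement about one of the systems.
\<close>

lemma (in prob_space) is_cond_prob_prod:
  fixes h :: "'i \<Rightarrow> 'a \<Rightarrow> 'h" and x :: "'i \<Rightarrow> 'a \<Rightarrow> 'x"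
  assumes I: "finite I"
    and ind: "indep_vars (\<lambda>i. H i \<Otimes>\<^sub>M X i) (\<lambda>i \<omega>. (h i \<omega>, x i \<omega>)) I"
    and A: "\<And>i. i \<in> I \<Longrightarrow> A i \<in> sets (H i)"
    and f: "\<And>i. i \<in> I \<Longrightarrow> is_cond_prob M {\<omega> \<in> space M. h i \<omega> \<in> A i} (X i) (x i) (f i)"
  shows "is_cond_prob M {\<omega> \<in> space M. \<forall>i\<in>I. h i \<omega> \<in> A i} (PiM I X)
    (\<lambda>\<omega>. \<lambda>i\<in>I. x i \<omega>) (\<lambda>y. \<Prod>i\<in>I. f i (y i))"
proof -
  let ?E = "{\<omega> \<in> space M. \<forall>i\<in>I. h i \<omega> \<in> A i}"
  let ?Y = "\<lambda>\<omega>. \<lambda>i\<in>I. x i \<omega>"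
  let ?f = "\<lambda>y. \<Prod>i\<in>I. f i (y i)"
  have pair: "(\<lambda>\<omega>. (h i \<omega>, x i \<omega>)) \<in> measurable M (H i \<Otimes>\<^sub>M X i)" if "i \<in> I" for i
    using ind that by (simp add: indep_vars_def)
  have h: "h i \<in> measurable M (H i)" and x: "x i \<in> measurable M (X i)" if "i \<in> I" for i
    using measurable_compose[OF pair[OF that] measurable_fst]
      measurable_compose[OF pair[OF that] measurable_snd] by simp_all
  have E1: "{\<omega> \<in> space M. h i \<omega> \<in> A i} \<in> sets M" if "i \<in> I" for i
    using measurable_sets[OF h A, OF that that] by (simp add: vimage_def Int_def conj_commute)
  have E: "?E \<in> sets M" by (intro sets.sets_Collect_finite_All E1 I)
  have Y: "?Y \<in> measurable M (PiM I X)" by (intro measurable_restrict x)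
  have fm: "f i \<in> borel_measurable (X i)" if "i \<in> I" for i
    using f[OF that] by (simp add: is_cond_prob_def)
  have f01: "0 \<le> f i z \<and> f i z \<le> 1" if "i \<in> I" "z \<in> space (X i)" for i z
    using f[OF that(1)] that(2) by (simp add: is_cond_prob_def)
  have fpm: "?f \<in> borel_measurable (PiM I X)"
  proof (rule borel_measurable_prod)
    fix i assume i: "i \<in> I"
    show "(\<lambda>y. f i (y i)) \<in> borel_measurable (PiM I X)"
      using measurable_component_singleton[OF i, of X] fm[OF i] by (rule measurable_compose)
  qed
  have fp01: "0 \<le> ?f y \<and> ?f y \<le> 1" if "y \<in> space (PiM I X)" for y
    using that by (auto simp: space_PiM PiE_iff intro!: prod_nonneg prod_le_1 dest: f01)
  have P: "emeasure (distr (density M (indicator ?E)) (PiM I X) ?Y) C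
      = (\<integral>\<^sup>+\<omega>. indicator ?E \<omega> * indicator C (?Y \<omega>) \<partial>M)" if "C \<in> sets (PiM I X)" for C
    using E Y that
    by (auto simp: emeasure_distr emeasure_density intro!: nn_integral_cong split: split_indicator)
  have "distr (density M (indicator ?E)) (PiM I X) ?Y
      = density (distr M (PiM I X) ?Y) (\<lambda>y. ennreal (?f y))" (is "?P = ?Q")
  proof (rule measure_eqI_PiM_finite[OF I, where A="\<lambda>_. space (PiM I X)"])
    fix B assume B: "\<And>i. i \<in> I \<Longrightarrow> B i \<in> sets (X i)"
    then have PB[measurable]: "Pi\<^sub>E I B \<in> sets (PiM I X)" by (intro sets_PiM_I_finite I) auto
    let ?u = "\<lambda>i z. indicator (A i) (fst z) * indicator (B i) (snd z) :: ennreal"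
    let ?v = "\<lambda>i z. ennreal (f i (snd z)) * indicator (B i) (snd z) :: ennreal"
    have um: "?u i \<in> borel_measurable (H i \<Otimes>\<^sub>M X i)" and vm: "?v i \<in> borel_measurable (H i \<Otimes>\<^sub>M X i)"
      if "i \<in> I" for i
      using A[OF that] B[OF that] fm[OF that] by measurable
    have ind_prod: "(\<integral>\<^sup>+\<omega>. (\<Prod>i\<in>I. w i (h i \<omega>, x i \<omega>)) \<partial>M) = (\<Prod>i\<in>I. \<integral>\<^sup>+\<omega>. w i (h i \<omega>, x i \<omega>) \<partial>M)"
      if "\<And>i. i \<in> I \<Longrightarrow> w i \<in> borel_measurable (H i \<Otimes>\<^sub>M X i)"
      for w :: "'i \<Rightarrow> 'h \<times> 'x \<Rightarrow> ennreal"
      using that by (intro indep_vars_nn_integral I indep_vars_compose2[OF ind]) auto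
    have prod_ind: "indicator (Pi\<^sub>E I B) (?Y \<omega>) = (\<Prod>i\<in>I. indicator (B i) (x i \<omega>) :: ennreal)" for \<omega>
      using I by (auto simp: indicator_def PiE_iff prod_zero_iff)
    have "emeasure ?P (Pi\<^sub>E I B)
        = (\<integral>\<^sup>+\<omega>. indicator ?E \<omega> * indicator (Pi\<^sub>E I B) (?Y \<omega>) \<partial>M)"
      by (rule P[OF PB])
    also have "\<dots> = (\<integral>\<^sup>+\<omega>. (\<Prod>i\<in>I. ?u i (h i \<omega>, x i \<omega>)) \<partial>M)"
    proof (rule nn_integral_cong)
      fix \<omega> assume "\<omega> \<in> space M"
      then have "indicator ?E \<omega> = (\<Prod>i\<in>I. indicator (A i) (h i \<omega>) :: ennreal)"
        using I by (auto simp: indicator_def prod_zero_iff)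
      then show "indicator ?E \<omega> * indicator (Pi\<^sub>E I B) (?Y \<omega>) = (\<Prod>i\<in>I. ?u i (h i \<omega>, x i \<omega>))"
        unfolding prod_ind by (simp add: prod.distrib)
    qed
    also have "\<dots> = (\<Prod>i\<in>I. \<integral>\<^sup>+\<omega>. ?u i (h i \<omega>, x i \<omega>) \<partial>M)"
      by (rule ind_prod[OF um])
    also have "\<dots> = (\<Prod>i\<in>I. \<integral>\<^sup>+\<omega>. ?v i (h i \<omega>, x i \<omega>) \<partial>M)"
    proof (rule prod.cong[OF refl])
      fix i assume i: "i \<in> I"
      have "(\<integral>\<^sup>+\<omega>. ?u i (h i \<omega>, x i \<omega>) \<partial>M)
          = (\<integral>\<^sup>+\<omega>. indicator {\<omega> \<in> space M. h i \<omega> \<in> A i} \<omega> * indicator (B i) (x i \<omega>) \<partial>M)"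
        by (intro nn_integral_cong) (auto split: split_indicator)
      also have "\<dots> = (\<integral>\<^sup>+\<omega>. ennreal (f i (x i \<omega>)) * indicator (B i) (x i \<omega>) \<partial>M)"
        using B[OF i] by (intro is_cond_prob_nn_integral[OF f[OF i] E1[OF i] x[OF i]]) auto
      finally show "(\<integral>\<^sup>+\<omega>. ?u i (h i \<omega>, x i \<omega>) \<partial>M) = (\<integral>\<^sup>+\<omega>. ?v i (h i \<omega>, x i \<omega>) \<partial>M)"
        by simp
    qed
    also have "\<dots> = (\<integral>\<^sup>+\<omega>. (\<Prod>i\<in>I. ?v i (h i \<omega>, x i \<omega>)) \<partial>M)"
      by (rule ind_prod[OF vm, symmetric])
    also have "\<dots> = (\<integral>\<^sup>+\<omega>. ennreal (?f (?Y \<omega>)) * indicator (Pi\<^sub>E I B) (?Y \<omega>) \<partial>M)"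
    proof (rule nn_integral_cong)
      fix \<omega> assume "\<omega> \<in> space M"
      then have "\<And>i. i \<in> I \<Longrightarrow> 0 \<le> f i (x i \<omega>)" using f01 measurable_space[OF x] by blast
      then have "ennreal (\<Prod>i\<in>I. f i (x i \<omega>)) = (\<Prod>i\<in>I. ennreal (f i (x i \<omega>)))"
        by (simp add: prod_ennreal)
      then show "(\<Prod>i\<in>I. ?v i (h i \<omega>, x i \<omega>)) = ennreal (?f (?Y \<omega>)) * indicator (Pi\<^sub>E I B) (?Y \<omega>)"
        unfolding prod_ind by (simp add: prod.distrib)
    qed
    also have "\<dots> = emeasure ?Q (Pi\<^sub>E I B)"
      using fpm Y by (simp add: emeasure_density nn_integral_distr)
    finally show "emeasure ?P (Pi\<^sub>E I B) = emeasure ?Q (Pi\<^sub>E I B)" .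
  next
    show "range (\<lambda>_. space (PiM I X)) \<subseteq> prod_algebra I X"
      using I by (auto simp: space_PiM intro!: prod_algebraI_finite)
    have "emeasure ?P (space (PiM I X)) \<le> (\<integral>\<^sup>+\<omega>. 1 \<partial>M)"
      unfolding P[OF sets.top] by (intro nn_integral_mono) (auto split: split_indicator)
    then show "emeasure ?P (space (PiM I X)) \<noteq> \<infinity>"
      by (auto simp: emeasure_space_1 top_unique)
  qed auto
  then show ?thesis
    using fpm fp01 by (simp add: is_cond_prob_iff_density[OF E Y])
qed

section \<open>Posteriors\<close>

text \<open>
  A posterior lives on the product space of unknowns and data. Being determined by the joint law, it
  remains a conditional probability on any probability space that carries the system, along with
  other systems or with randomized decisions.
\<close>

lemma (in prob_space) is_cond_prob_posterior:
  assumes sys: "system_on M H X K \<pi> h x" and pi: "prior_on H \<pi>"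
    and K: "K \<in> measurable H (prob_algebra X)" and A[measurable]: "A \<in> sets H"
    and f: "is_posterior H X K \<pi> A f"
  shows "is_cond_prob M {\<omega> \<in> space M. h \<omega> \<in> A} X x f"
proof -
  let ?J = "joint_law H X K \<pi>"
  have [measurable]: "h \<in> measurable M H" "x \<in> measurable M X"
    and J: "?J = distr M (H \<Otimes>\<^sub>M X) (\<lambda>\<omega>. (h \<omega>, x \<omega>))"
    using sys by (auto simp: system_on_def)
  have val: "h \<omega> \<in> space H" "x \<omega> \<in> space X" if "\<omega> \<in> space M" for \<omega>
    using that by (auto intro: measurable_space)
  have fm[measurable]: "f \<in> borel_measurable X" and f01: "\<And>y. y \<in> space X \<Longrightarrow> 0 \<le> f y \<and> f y \<le> 1"
    using f by (auto simp: is_posterior_def is_cond_prob_def)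
  have spJ: "space ?J = space (H \<Otimes>\<^sub>M X)" by (simp add: J)
  have [measurable]: "Measurable.pred ?J (\<lambda>z. fst z \<in> A)" "snd \<in> measurable ?J X"
    by (simp_all add: J)
  interpret J: prob_space ?J by (rule joint_law_simps[OF pi K])
  show ?thesis
  proof (rule is_cond_probI)
    fix B assume B[measurable]: "B \<in> sets X"
    let ?E = "{z \<in> space (H \<Otimes>\<^sub>M X). fst z \<in> A}"
    have "(\<integral>\<^sup>+\<omega>. indicator {\<omega> \<in> space M. h \<omega> \<in> A} \<omega> * indicator B (x \<omega>) \<partial>M)
        = (\<integral>\<^sup>+\<omega>. indicator ?E (h \<omega>, x \<omega>) * indicator B (x \<omega>) \<partial>M)"
      by (intro nn_integral_cong) (auto simp: space_pair_measure val split: split_indicator)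
    also have "\<dots> = (\<integral>\<^sup>+z. indicator ?E z * indicator B (snd z) \<partial>?J)"
      by (simp add: J nn_integral_distr)
    also have "\<dots> = (\<integral>\<^sup>+z. ennreal (f (snd z)) * indicator B (snd z) \<partial>?J)"
      by (rule J.is_cond_prob_nn_integral[OF f[unfolded is_posterior_def spJ]]) (simp_all add: J)
    also have "\<dots> = (\<integral>\<^sup>+\<omega>. ennreal (f (x \<omega>)) * indicator B (x \<omega>) \<partial>M)"
      by (simp add: J nn_integral_distr)
    finally show "(\<integral>\<^sup>+\<omega>. indicator {\<omega> \<in> space M. h \<omega> \<in> A} \<omega> * indicator B (x \<omega>) \<partial>M)
        = (\<integral>\<^sup>+\<omega>. ennreal (f (x \<omega>)) * indicator B (x \<omega>) \<partial>M)" .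
  qed (use fm f01 in auto)
qed

text \<open>
  The marginal law of the data is \<open>\<pi> \<bind> K\<close>, so a property of the data alone passes from the
  joint law to it.
\<close>

lemma AE_marginal_of_joint:
  assumes pi: "prior_on H \<pi>" and K: "K \<in> measurable H (prob_algebra X)"
    and P[measurable]: "Measurable.pred X P"
    and ae: "AE z in joint_law H X K \<pi>. P (snd z)"
  shows "AE x in \<pi> \<bind> K. P x"
proof -
  let ?J = "joint_law H X K \<pi>"
  interpret pi: prob_space \<pi> by (rule prior_on_simps[OF pi])
  have K': "K \<in> measurable \<pi> (subprob_algebra X)"
    using measurable_prob_algebraD[OF K] prior_on_simps(2)[OF pi] by (simp cong: measurable_cong_sets)
  have sK: "sets (\<pi> \<bind> K) = sets X"
    by (rule sets_bind[OF sets_kernel[OF K']]) (auto simp: pi.not_empty)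
  have spK: "space (\<pi> \<bind> K) = space X" by (rule sets_eq_imp_space_eq[OF sK])
  have snd: "snd \<in> measurable ?J X"
    unfolding measurable_cong_sets[OF joint_law_simps(1)[OF pi K] refl] by simp
  let ?N = "{x \<in> space X. \<not> P x}"
  have "emeasure (\<pi> \<bind> K) ?N = (\<integral>\<^sup>+h. emeasure (K h) ?N \<partial>\<pi>)"
    by (rule emeasure_bind[OF _ K']) (auto simp: pi.not_empty)
  also have "\<dots> = (\<integral>\<^sup>+h. \<integral>\<^sup>+x. indicator ?N (snd (h, x)) \<partial>K h \<partial>\<pi>)"
    using sets_kernel[OF K'] by (intro nn_integral_cong) (simp add: nn_integral_indicator)
  also have "\<dots> = (\<integral>\<^sup>+z. indicator ?N (snd z) \<partial>?J)"
    by (rule nn_integral_joint_law[OF pi K, symmetric]) measurable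
  also have "\<dots> = (\<integral>\<^sup>+z. 0 \<partial>?J)"
    using ae by (intro nn_integral_cong_AE) (auto elim!: AE_mp)
  finally show ?thesis
    by (intro AE_I[where N="?N"]) (auto simp: sK spK)
qed

lemma is_cond_prob_independent_systems:
  assumes sys: "independent_systems_on M H X K N \<pi> h x"
    and K: "K \<in> measurable H (prob_algebra X)"
    and A: "\<And>n. n \<in> {1..N} \<Longrightarrow> A n \<in> sets H"
    and f: "\<And>n. n \<in> {1..N} \<Longrightarrow> is_posterior H X K (\<pi> n) (A n) (f n)"
    and N: "1 \<le> N"
  shows "is_cond_prob M {\<omega> \<in> space M. \<forall>n\<in>{1..N}. h n \<omega> \<in> A n} (PiM {1..N} (\<lambda>_. X))
    (\<lambda>\<omega>. \<lambda>n\<in>{1..N}. x n \<omega>) (\<lambda>y. \<Prod>n\<in>{1..N}. f n (y n))"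
proof -
  have sysn: "prior_on H (\<pi> n)" "system_on M H X K (\<pi> n) (h n) (x n)" if "n \<in> {1..N}" for n
    using sys that by (auto simp: independent_systems_on_def)
  interpret prob_space M using sysn(2)[of 1] N by (simp add: system_on_def)
  show ?thesis
  proof (rule is_cond_prob_prod)
    show "indep_vars (\<lambda>_. H \<Otimes>\<^sub>M X) (\<lambda>n \<omega>. (h n \<omega>, x n \<omega>)) {1..N}"
      using sys by (simp add: independent_systems_on_def)
    show "is_cond_prob M {\<omega> \<in> space M. h n \<omega> \<in> A n} X (x n) (f n)" if "n \<in> {1..N}" for n
      using is_cond_prob_posterior[OF sysn(2)[OF that] sysn(1)[OF that] K A[OF that] f[OF that]] .
  qed (use A in auto)
qed

lemma is_posterior_space:
  assumes pi: "prior_on H \<pi>" and K: "K \<in> measurable H (prob_algebra X)"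
  shows "is_posterior H X K \<pi> (space H) (\<lambda>_. 1)"
proof -
  let ?J = "joint_law H X K \<pi>"
  interpret J: prob_space ?J by (rule joint_law_simps[OF pi K])
  note sJ[measurable_cong] = joint_law_simps(1)[OF pi K]
  have "{z \<in> space ?J. fst z \<in> space H} = space ?J"
    by (auto simp: sets_eq_imp_space_eq[OF sJ] space_pair_measure)
  then show ?thesis
    unfolding is_posterior_def by (intro J.is_cond_probI) (auto intro!: nn_integral_cong)
qed

lemma is_posterior_compl:
  assumes pi: "prior_on H \<pi>" and K: "K \<in> measurable H (prob_algebra X)"
    and A[measurable]: "A \<in> sets H" and f: "is_posterior H X K \<pi> A f"
  shows "is_posterior H X K \<pi> (space H - A) (\<lambda>x. 1 - f x)"
proof -
  let ?J = "joint_law H X K \<pi>"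
  interpret J: prob_space ?J by (rule joint_law_simps[OF pi K])
  note sJ[measurable_cong] = joint_law_simps(1)[OF pi K]
  have "{z \<in> space ?J. fst z \<in> space H - A} = space ?J - {z \<in> space ?J. fst z \<in> A}"
    by (auto simp: sets_eq_imp_space_eq[OF sJ] space_pair_measure)
  then show ?thesis
    using f unfolding is_posterior_def by (auto intro: J.is_cond_prob_compl)
qed

section \<open>Criteria for a single system and for several systems\<close>

lemma posterior_of_null_hypothesis:
  assumes pb: "testing_problem H X K H0 H1" and pi: "prior_on H \<pi>"
    and f: "is_posterior H X K \<pi> H1 f" and f': "is_posterior H X K \<pi> H0 f'"
  shows "AE x in \<pi> \<bind> K. f' x = 1 - f x"
proof -
  have H: "H1 \<in> sets H" "H0 = space H - H1" and K: "K \<in> measurable H (prob_algebra X)"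
    using pb by (auto simp: testing_problem_def)
  have [measurable]: "f \<in> borel_measurable X" "f' \<in> borel_measurable X"
    using f f' by (auto simp: is_posterior_def is_cond_prob_def)
  show ?thesis
  proof (rule AE_marginal_of_joint[OF pi K])
    show "AE z in joint_law H X K \<pi>. f' (snd z) = 1 - f (snd z)"
      using f' is_posterior_compl[OF pi K H(1) f] unfolding is_posterior_def H(2)
      by (rule is_cond_prob_unique)
  qed measurable
qed

lemma posterior_mono:
  assumes pi: "prior_on H \<pi>" and K: "K \<in> measurable H (prob_algebra X)"
    and A[measurable]: "A \<in> sets H" and B[measurable]: "B \<in> sets H" and AB: "A \<subseteq> B"
    and f: "is_posterior H X K \<pi> A f" and g: "is_posterior H X K \<pi> B g"
  shows "AE x in \<pi> \<bind> K. f x \<le> g x"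
proof -
  let ?J = "joint_law H X K \<pi>"
  interpret J: prob_space ?J by (rule joint_law_simps[OF pi K])
  note sJ[measurable_cong] = joint_law_simps(1)[OF pi K]
  have [measurable]: "f \<in> borel_measurable X" "g \<in> borel_measurable X"
    using f g by (auto simp: is_posterior_def is_cond_prob_def)
  show ?thesis
  proof (rule AE_marginal_of_joint[OF pi K])
    show "AE z in ?J. f (snd z) \<le> g (snd z)"
      using AB
      by (intro J.is_cond_prob_mono[OF f[unfolded is_posterior_def] g[unfolded is_posterior_def]]) auto
  qed measurable
qed

text \<open>
  By independence the probability of the conjunction is the product of \<open>N\<close> equal factors \<open>\<eta>\<close>.
\<close>

lemma conjunction_criterion:
  assumes sys: "independent_systems_on M H X K N \<pi> h x" and N: "1 < N"
    and K: "K \<in> measurable H (prob_algebra X)" and A: "A \<in> sets H"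
    and f: "\<And>n. n \<in> {1..N} \<Longrightarrow> is_posterior H X K (\<pi> n) A (f n)"
    and c: "is_cond_prob M {\<omega> \<in> space M. \<forall>n\<in>{1..N}. h n \<omega> \<in> A} (PiM {1..N} (\<lambda>_. X))
      (\<lambda>\<omega>. \<lambda>n\<in>{1..N}. x n \<omega>) c"
  shows "AE \<omega> in M. \<forall>\<eta>\<in>{0<..<1}. (\<forall>n\<in>{1..N}. f n (x n \<omega>) = \<eta>) \<longrightarrow> c (\<lambda>n\<in>{1..N}. x n \<omega>) < \<eta>"
proof -
  have "AE \<omega> in M. c (\<lambda>n\<in>{1..N}. x n \<omega>) = (\<Prod>n\<in>{1..N}. f n ((\<lambda>n\<in>{1..N}. x n \<omega>) n))"
    using N by (intro is_cond_prob_unique[OF c is_cond_prob_independent_systems[OF sys K A f]]) auto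
  then show ?thesis
  proof (eventually_elim, intro ballI impI)
    fix \<omega> and \<eta> :: real
    assume c: "c (\<lambda>n\<in>{1..N}. x n \<omega>) = (\<Prod>n\<in>{1..N}. f n ((\<lambda>n\<in>{1..N}. x n \<omega>) n))"
      and eta: "\<eta> \<in> {0<..<1}" and eq: "\<forall>n\<in>{1..N}. f n (x n \<omega>) = \<eta>"
    have "c (\<lambda>n\<in>{1..N}. x n \<omega>) = (\<Prod>n\<in>{1..N}. \<eta>)"
      unfolding c using eq by (intro prod.cong) auto
    also have "\<dots> = \<eta> ^ N" by simp
    also have "\<dots> < \<eta> ^ 1" using N eta by (intro power_strict_decreasing) auto
    finally show "c (\<lambda>n\<in>{1..N}. x n \<omega>) < \<eta>" by simp
  qed
qed

text \<open>
  The complementary event is a conjunction for the complementary hypothesis, so the disjunction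
  fails with probability \<open>(1 - \<eta>)\<^sup>N < 1 - \<eta>\<close>.
\<close>

lemma disjunction_criterion:
  assumes sys: "independent_systems_on M H X K N \<pi> h x" and N: "1 < N"
    and K: "K \<in> measurable H (prob_algebra X)" and A[measurable]: "A \<in> sets H"
    and f: "\<And>n. n \<in> {1..N} \<Longrightarrow> is_posterior H X K (\<pi> n) A (f n)"
    and c: "is_cond_prob M {\<omega> \<in> space M. \<exists>n\<in>{1..N}. h n \<omega> \<in> A} (PiM {1..N} (\<lambda>_. X))
      (\<lambda>\<omega>. \<lambda>n\<in>{1..N}. x n \<omega>) c"
  shows "AE \<omega> in M. \<forall>\<eta>\<in>{0<..<1}. (\<forall>n\<in>{1..N}. f n (x n \<omega>) = \<eta>) \<longrightarrow> c (\<lambda>n\<in>{1..N}. x n \<omega>) > \<eta>"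
proof -
  have pi: "prior_on H (\<pi> n)" and sysn: "system_on M H X K (\<pi> n) (h n) (x n)"
    if "n \<in> {1..N}" for n
    using sys that by (auto simp: independent_systems_on_def)
  have [measurable]: "h n \<in> measurable M H" "x n \<in> measurable M X" if "n \<in> {1..N}" for n
    using sysn[OF that] by (auto simp: system_on_def)
  have hn: "h n \<omega> \<in> space H" if "n \<in> {1..N}" "\<omega> \<in> space M" for n \<omega>
    using sysn[OF that(1)] that(2) by (auto simp: system_on_def dest: measurable_space)
  interpret prob_space M using sysn[of 1] N by (simp add: system_on_def)
  let ?E = "{\<omega> \<in> space M. \<exists>n\<in>{1..N}. h n \<omega> \<in> A}"
  have E: "?E \<in> sets M" by measurable
  have Y: "(\<lambda>\<omega>. \<lambda>n\<in>{1..N}. x n \<omega>) \<in> measurable M (PiM {1..N} (\<lambda>_. X))"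
    by (rule measurable_restrict) measurable
  have eqE: "space M - ?E = {\<omega> \<in> space M. \<forall>n\<in>{1..N}. h n \<omega> \<in> space H - A}"
    using hn by auto
  have "is_cond_prob M (space M - ?E) (PiM {1..N} (\<lambda>_. X)) (\<lambda>\<omega>. \<lambda>n\<in>{1..N}. x n \<omega>)
      (\<lambda>y. \<Prod>n\<in>{1..N}. 1 - f n (y n))"
    unfolding eqE using N
    by (intro is_cond_prob_independent_systems[OF sys K] is_posterior_compl pi K A f) auto
  from is_cond_prob_unique[OF is_cond_prob_compl[OF c E Y] this]
  have "AE \<omega> in M. 1 - c (\<lambda>n\<in>{1..N}. x n \<omega>) = (\<Prod>n\<in>{1..N}. 1 - f n ((\<lambda>n\<in>{1..N}. x n \<omega>) n))" .
  then show ?thesis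
  proof (eventually_elim, intro ballI impI)
    fix \<omega> and \<eta> :: real
    assume c: "1 - c (\<lambda>n\<in>{1..N}. x n \<omega>) = (\<Prod>n\<in>{1..N}. 1 - f n ((\<lambda>n\<in>{1..N}. x n \<omega>) n))"
      and eta: "\<eta> \<in> {0<..<1}" and eq: "\<forall>n\<in>{1..N}. f n (x n \<omega>) = \<eta>"
    have "1 - c (\<lambda>n\<in>{1..N}. x n \<omega>) = (\<Prod>n\<in>{1..N}. 1 - \<eta>)"
      unfolding c using eq by (intro prod.cong) auto
    also have "\<dots> = (1 - \<eta>) ^ N" by simp
    also have "\<dots> < (1 - \<eta>) ^ 1" using N eta by (intro power_strict_decreasing) auto
    finally show "c (\<lambda>n\<in>{1..N}. x n \<omega>) > \<eta>" by simp
  qed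
qed

text \<open>
  The event \<open>h\<^sub>1 \<in> A\<close> is a conjunction in which all other systems have the trivial hypothesis, whose
  posterior is the constant \<open>1\<close>.
\<close>

lemma multiplicity_criterion:
  assumes sys: "independent_systems_on M H X K N \<pi> h x" and N: "1 \<le> N"
    and K: "K \<in> measurable H (prob_algebra X)" and A: "A \<in> sets H"
    and f: "is_posterior H X K (\<pi> 1) A f"
    and c: "is_cond_prob M {\<omega> \<in> space M. h 1 \<omega> \<in> A} (PiM {1..N} (\<lambda>_. X))
      (\<lambda>\<omega>. \<lambda>n\<in>{1..N}. x n \<omega>) c"
  shows "AE \<omega> in M. c (\<lambda>n\<in>{1..N}. x n \<omega>) = f (x 1 \<omega>)"
proof -
  have pi: "prior_on H (\<pi> n)" and sysn: "system_on M H X K (\<pi> n) (h n) (x n)"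
    if "n \<in> {1..N}" for n
    using sys that by (auto simp: independent_systems_on_def)
  have hn: "h n \<omega> \<in> space H" if "n \<in> {1..N}" "\<omega> \<in> space M" for n \<omega>
    using sysn[OF that(1)] that(2) by (auto simp: system_on_def dest: measurable_space)
  let ?A = "\<lambda>n. if n = 1 then A else space H"
  let ?f = "\<lambda>n. if n = 1 then f else (\<lambda>_. 1)"
  have E: "{\<omega> \<in> space M. \<forall>n\<in>{1..N}. h n \<omega> \<in> ?A n} = {\<omega> \<in> space M. h 1 \<omega> \<in> A}"
    using N hn by (auto split: if_splits)
  have prod: "(\<Prod>n\<in>{1..N}. ?f n (y n)) = f (y 1)" for y :: "nat \<Rightarrow> 'c"
  proof -
    have "(\<Prod>n\<in>{1..N}. ?f n (y n)) = (\<Prod>n\<in>{1..N}. if n = 1 then f (y n) else 1)"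
      by (intro prod.cong) auto
    also have "\<dots> = f (y 1)" using N by (simp add: prod.delta)
    finally show ?thesis .
  qed
  have "is_cond_prob M {\<omega> \<in> space M. \<forall>n\<in>{1..N}. h n \<omega> \<in> ?A n} (PiM {1..N} (\<lambda>_. X))
      (\<lambda>\<omega>. \<lambda>n\<in>{1..N}. x n \<omega>) (\<lambda>y. \<Prod>n\<in>{1..N}. ?f n (y n))"
    using A f pi is_posterior_space[OF pi K]
    by (intro is_cond_prob_independent_systems[OF sys K _ _ N]) auto
  then have "is_cond_prob M {\<omega> \<in> space M. h 1 \<omega> \<in> A} (PiM {1..N} (\<lambda>_. X))
      (\<lambda>\<omega>. \<lambda>n\<in>{1..N}. x n \<omega>) (\<lambda>y. f (y 1))"
    unfolding E prod .
  from is_cond_prob_unique[OF c this] show ?thesis using N by simp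
qed

section \<open>Sequential data collection\<close>

definition threshold_plan ::
    "real \<Rightarrow> (nat \<Rightarrow> (nat \<Rightarrow> 'y) \<Rightarrow> real) \<Rightarrow> nat \<Rightarrow> (nat \<Rightarrow> 'y) \<Rightarrow> real" where
  "threshold_plan \<eta> post k y = (if \<eta> \<le> post k y then 1 else 0)"

lemma analysis_plan_threshold:
  assumes post: "\<And>k. post k \<in> borel_measurable (PiM {1..k} Y)"
  shows "analysis_plan Y post \<eta> (threshold_plan \<eta> post)"
  unfolding analysis_plan_def
proof (intro conjI allI ballI impI)
  fix k
  note [measurable] = post[of k]
  show "threshold_plan \<eta> post k \<in> borel_measurable (PiM {1..k} Y)"
    unfolding threshold_plan_def[abs_def] by measurable
next
  fix k :: nat and x and u :: "nat \<Rightarrow> real"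
  assume "\<forall>j. u j \<in> {0<..<1}" "quits_at (threshold_plan \<eta> post) x u k"
  then have "0 < u k" "u k < threshold_plan \<eta> post k (restrict x {1..k})"
    by (auto simp: quits_at_def)
  then show "\<eta> \<le> post k (restrict x {1..k})"
    by (auto simp: threshold_plan_def split: if_splits)
qed (auto simp: threshold_plan_def)

text \<open>
  A plan that quits at \<open>k\<close> has reached the threshold by then, and the threshold plan stops as soon as
  that happens. So it quits no later on the same data and the same random numbers.
\<close>

lemma quits_at_threshold_plan:
  assumes D: "analysis_plan Y post \<eta> D" and x: "x \<in> space (PiM {1..} Y)"
    and u: "\<And>j. u j \<in> {0<..<1}" and quit: "quits_at D x u k"
  shows "\<exists>j\<le>k. quits_at (threshold_plan \<eta> post) x u j"
proof -
  define m where "m = (LEAST j. \<eta> \<le> post j (restrict x {1..j}))"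
  have "\<eta> \<le> post k (restrict x {1..k})"
    using D[unfolded analysis_plan_def, THEN conjunct2, THEN conjunct2] x u quit by blast
  then have m: "\<eta> \<le> post m (restrict x {1..m})" "m \<le> k"
    unfolding m_def by (rule LeastI, rule Least_le)
  have less: "\<not> \<eta> \<le> post i (restrict x {1..i})" if "i < m" for i
    using that unfolding m_def by (rule not_less_Least)
  have "0 \<le> u i" "u i < 1" for i using u[of i] by auto
  then have "quits_at (threshold_plan \<eta> post) x u m"
    unfolding quits_at_def threshold_plan_def using m(1) less by (auto simp: not_less)
  with m(2) show ?thesis by blast
qed

lemma AE_uniform_sequence:
  "AE u in PiM UNIV (\<lambda>_::nat. uniform_measure lborel {0<..<1::real}). \<forall>j. u j \<in> {0<..<1}"
proof -
  have ps: "prob_space (uniform_measure lborel {0<..<1::real})"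
    by (rule prob_space_uniform_measure) auto
  have "AE t in uniform_measure lborel {0<..<1::real}. t \<in> {0<..<1}"
    by (rule AE_uniform_measureI) auto
  then show ?thesis
    unfolding AE_all_countable using ps by (intro allI AE_PiM_component) auto
qed

text \<open>
  The pathwise comparison is integrated under the law of the data for one true value \<open>h\<close>. It can
  fail only on the null set where some random number lies outside \<open>(0, 1)\<close>: a number of at least
  \<open>1\<close>, for instance, lets the threshold plan go on with the threshold reached.
\<close>

lemma conclude_prob_le_threshold_plan:
  assumes L: "\<And>i. 1 \<le> i \<Longrightarrow> L i \<in> measurable H (prob_algebra (Y i))"
    and post: "\<And>k. post k \<in> borel_measurable (PiM {1..k} Y)"
    and D: "analysis_plan Y post \<eta> D" and h: "h \<in> space H"
  shows "conclude_prob L D k h \<le> conclude_prob L (threshold_plan \<eta> post) k h"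
proof -
  let ?D = "threshold_plan \<eta> post"
  let ?U = "PiM UNIV (\<lambda>_::nat. uniform_measure lborel {0<..<1::real})"
  let ?S = "seq_lik L h"
  let ?P = "?S \<Otimes>\<^sub>M ?U"
  have "L i h \<in> space (prob_algebra (Y i))" if "1 \<le> i" for i
    using measurable_space[OF L[OF that] h] .
  then have psL: "prob_space (L i h)" and setsL: "sets (L i h) = sets (Y i)" if "1 \<le> i" for i
    using that by (auto simp: space_prob_algebra)
  have sS[measurable_cong]: "sets ?S = sets (PiM {1..} Y)"
    unfolding seq_lik_def by (rule sets_PiM_cong) (auto simp: setsL)
  have sU[measurable_cong]: "sets ?U = sets (PiM UNIV (\<lambda>_::nat. borel :: real measure))"
    by (rule sets_PiM_cong) auto
  have spS: "space ?S = space (PiM {1..} Y)" by (rule sets_eq_imp_space_eq[OF sS])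
  interpret S: prob_space ?S
    unfolding seq_lik_def by (rule prob_space_PiM) (auto simp: psL)
  interpret U: prob_space ?U
    by (intro prob_space_PiM prob_space_uniform_measure) auto
  interpret SU: pair_prob_space ?S ?U ..
  have [measurable]: "?D j \<in> borel_measurable (PiM {1..j} Y)" for j
    using analysis_plan_threshold[OF post] by (simp add: analysis_plan_def)
  have [measurable]: "(\<lambda>x. restrict x {1..j}) \<in> measurable (PiM {1..} Y) (PiM {1..j} Y)" for j
    by (rule measurable_restrict_subset) auto
  have quit: "Measurable.pred ?P (\<lambda>z. snd z j < ?D j (restrict (fst z) {1..j}))" for j
    by measurable
  have "{(x, u) \<in> space ?P. \<exists>j\<le>k. quits_at ?D x u j} =
      {z \<in> space ?P. \<exists>j\<in>{..k}. snd z j < ?D j (restrict (fst z) {1..j}) \<and>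
        (\<forall>i\<in>{..<j}. \<not> snd z i < ?D i (restrict (fst z) {1..i}))}"
    by (auto simp: quits_at_def)
  also have "\<dots> \<in> sets ?P" using quit by measurable
  finally have meas: "{(x, u) \<in> space ?P. \<exists>j\<le>k. quits_at ?D x u j} \<in> sets ?P" .
  have "AE z in ?P. \<forall>j. snd z j \<in> {0<..<1}"
    by (rule SU.AE_pair_measure) (use AE_uniform_sequence in \<open>auto\<close>)
  then have "AE z in ?P. z \<in> {(x, u) \<in> space ?P. \<exists>j\<le>k. quits_at D x u j} \<longrightarrow>
      z \<in> {(x, u) \<in> space ?P. \<exists>j\<le>k. quits_at ?D x u j}"
  proof (rule AE_mp, intro AE_I2 impI)
    fix z assume z: "\<forall>j. snd z j \<in> {0<..<1::real}" "z \<in> {(x, u) \<in> space ?P. \<exists>j\<le>k. quits_at D x u j}"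
    obtain x u where xu: "z = (x, u)" by (cases z)
    from z(2) obtain j where j: "j \<le> k" "quits_at D x u j" and x: "x \<in> space (PiM {1..} Y)"
      by (auto simp: xu space_pair_measure spS)
    then obtain i where "i \<le> j" "quits_at ?D x u i"
      using quits_at_threshold_plan[OF D x _ j(2)] z(1) by (auto simp: xu)
    with j(1) z(2) show "z \<in> {(x, u) \<in> space ?P. \<exists>j\<le>k. quits_at ?D x u j}"
      by (auto simp: xu intro: order_trans)
  qed
  then show ?thesis
    unfolding conclude_prob_def Let_def by (rule SU.finite_measure_mono_AE) (rule meas)
qed

section \<open>The criteria of the Bayesian method\<close>

theorem mainTheorem2:
  fixes H :: "'h measure" and X :: "'x measure" and K :: "'h \<Rightarrow> 'x measure"
    and H0 H1 :: "'h set" and \<pi> :: "'h measure"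
  assumes problem: "testing_problem H X K H0 H1"
    and prior: "prior_on H \<pi>"
  shows
    "\<comment> \<open>Complementarity\<close>
     (\<forall>f f'. is_posterior H X K \<pi> H1 f \<longrightarrow> is_posterior H X K \<pi> H0 f' \<longrightarrow>
        (AE x in \<pi> \<bind> K. \<forall>\<eta> \<eta>'. f x = \<eta> \<longrightarrow> f' x = \<eta>' \<longrightarrow> \<eta>' \<le> 1 - \<eta>)) \<and>
    \<comment> \<open>Inclusion\<close>
     (\<forall>H1' f f'. H1' \<in> sets H \<longrightarrow> H1 \<subseteq> H1' \<longrightarrow>
        is_posterior H X K \<pi> H1 f \<longrightarrow> is_posterior H X K \<pi> H1' f' \<longrightarrow>
        (AE x in \<pi> \<bind> K. f x \<le> f' x)) \<and>
    \<comment> \<open>Intention\<close>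
     (\<forall>(M :: 'w measure) h x1 S s g f fS.
        system_on M H X K \<pi> h x1 \<longrightarrow> S \<in> sets M \<longrightarrow>
        is_cond_prob M S X x1 s \<longrightarrow>
        is_cond_prob M S (X \<Otimes>\<^sub>M H) (\<lambda>\<omega>. (x1 \<omega>, h \<omega>)) g \<longrightarrow>
        (AE \<omega> in M. g (x1 \<omega>, h \<omega>) = s (x1 \<omega>)) \<longrightarrow>
        is_posterior H X K \<pi> H1 f \<longrightarrow>
        is_cond_prob M {\<omega> \<in> space M. h \<omega> \<in> H1} (count_space UNIV \<Otimes>\<^sub>M X)
          (\<lambda>\<omega>. (\<omega> \<in> S, x1 \<omega>)) fS \<longrightarrow>
        (AE \<omega> in M. \<omega> \<in> S \<longrightarrow> fS (True, x1 \<omega>) = f (x1 \<omega>))) \<and>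
    \<comment> \<open>Conjunction\<close>
     (\<forall>(M :: 'w measure) N \<pi>s h x f c.
        N > 1 \<longrightarrow> independent_systems_on M H X K N \<pi>s h x \<longrightarrow>
        (\<forall>n\<in>{1..N}. is_posterior H X K (\<pi>s n) H1 (f n)) \<longrightarrow>
        is_cond_prob M {\<omega> \<in> space M. \<forall>n\<in>{1..N}. h n \<omega> \<in> H1} (PiM {1..N} (\<lambda>_. X))
          (\<lambda>\<omega>. \<lambda>n\<in>{1..N}. x n \<omega>) c \<longrightarrow>
        (AE \<omega> in M. \<forall>\<eta>\<in>{0<..<1}. (\<forall>n\<in>{1..N}. f n (x n \<omega>) = \<eta>) \<longrightarrow>
          c (\<lambda>n\<in>{1..N}. x n \<omega>) < \<eta>)) \<and>
    \<comment> \<open>Disjunction\<close>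
     (\<forall>(M :: 'w measure) N \<pi>s h x f c.
        N > 1 \<longrightarrow> independent_systems_on M H X K N \<pi>s h x \<longrightarrow>
        (\<forall>n\<in>{1..N}. is_posterior H X K (\<pi>s n) H1 (f n)) \<longrightarrow>
        is_cond_prob M {\<omega> \<in> space M. \<exists>n\<in>{1..N}. h n \<omega> \<in> H1} (PiM {1..N} (\<lambda>_. X))
          (\<lambda>\<omega>. \<lambda>n\<in>{1..N}. x n \<omega>) c \<longrightarrow>
        (AE \<omega> in M. \<forall>\<eta>\<in>{0<..<1}. (\<forall>n\<in>{1..N}. f n (x n \<omega>) = \<eta>) \<longrightarrow>
          c (\<lambda>n\<in>{1..N}. x n \<omega>) > \<eta>)) \<and>
    \<comment> \<open>Multiplicity: for every N the conclusion is the same function f of x_1 alone\<close>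
     (\<forall>(M :: 'w measure) N \<pi>s h x f c.
        N \<ge> 1 \<longrightarrow> independent_systems_on M H X K N \<pi>s h x \<longrightarrow>
        is_posterior H X K (\<pi>s 1) H1 f \<longrightarrow>
        is_cond_prob M {\<omega> \<in> space M. h 1 \<omega> \<in> H1} (PiM {1..N} (\<lambda>_. X))
          (\<lambda>\<omega>. \<lambda>n\<in>{1..N}. x n \<omega>) c \<longrightarrow>
        (AE \<omega> in M. c (\<lambda>n\<in>{1..N}. x n \<omega>) = f (x 1 \<omega>))) \<and>
    \<comment> \<open>Sequential Optimality\<close>
     (\<forall>(Y :: nat \<Rightarrow> 'y measure) L post.
        (\<forall>i\<ge>1. L i \<in> measurable H (prob_algebra (Y i))) \<longrightarrow>
        (\<forall>k. is_seq_posterior H Y L \<pi> H1 k (post k)) \<longrightarrow>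
        (\<forall>\<eta>\<in>{0..1}. \<exists>D. analysis_plan Y post \<eta> D \<and>
          (\<forall>D'. analysis_plan Y post \<eta> D' \<longrightarrow>
            (\<forall>h\<in>H1. \<forall>k. conclude_prob L D k h \<ge> conclude_prob L D' k h))))"
proof -
  have H1: "H1 \<in> sets H" and K: "K \<in> measurable H (prob_algebra X)"
    using problem by (auto simp: testing_problem_def)
  show ?thesis
  proof (intro conjI allI impI ballI)
    fix f f'
    assume f: "is_posterior H X K \<pi> H1 f" "is_posterior H X K \<pi> H0 f'"
    show "AE x in \<pi> \<bind> K. \<forall>\<eta> \<eta>'. f x = \<eta> \<longrightarrow> f' x = \<eta>' \<longrightarrow> \<eta>' \<le> 1 - \<eta>"
      using posterior_of_null_hypothesis[OF problem prior f] by eventually_elim simp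
  next
    fix H1' f f'
    assume "H1' \<in> sets H" "H1 \<subseteq> H1'" "is_posterior H X K \<pi> H1 f" "is_posterior H X K \<pi> H1' f'"
    then show "AE x in \<pi> \<bind> K. f x \<le> f' x"
      using posterior_mono[OF prior K H1] by blast
  next
    fix M :: "'w measure" and h x1 S s g f fS
    assume sys: "system_on M H X K \<pi> h x1" and S: "S \<in> sets M"
      and s: "is_cond_prob M S X x1 s"
      and g: "is_cond_prob M S (X \<Otimes>\<^sub>M H) (\<lambda>\<omega>. (x1 \<omega>, h \<omega>)) g"
      and gs: "AE \<omega> in M. g (x1 \<omega>, h \<omega>) = s (x1 \<omega>)"
      and f: "is_posterior H X K \<pi> H1 f"
      and fS: "is_cond_prob M {\<omega> \<in> space M. h \<omega> \<in> H1} (count_space UNIV \<Otimes>\<^sub>M X)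
          (\<lambda>\<omega>. (\<omega> \<in> S, x1 \<omega>)) fS"
    interpret prob_space M using sys by (simp add: system_on_def)
    show "AE \<omega> in M. \<omega> \<in> S \<longrightarrow> fS (True, x1 \<omega>) = f (x1 \<omega>)"
      using sys by (intro is_cond_prob_given_irrelevant_event[OF _ _ S H1 s g gs
          is_cond_prob_posterior[OF sys prior K H1 f] fS]) (auto simp: system_on_def)
  next
    fix M :: "'w measure" and N \<pi>s h x f c
    assume N: "1 < N" and sys: "independent_systems_on M H X K N \<pi>s h x"
      and f: "\<forall>n\<in>{1..N}. is_posterior H X K (\<pi>s n) H1 (f n)"
      and c: "is_cond_prob M {\<omega> \<in> space M. \<forall>n\<in>{1..N}. h n \<omega> \<in> H1} (PiM {1..N} (\<lambda>_. X))
          (\<lambda>\<omega>. \<lambda>n\<in>{1..N}. x n \<omega>) c"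
    show "AE \<omega> in M. \<forall>\<eta>\<in>{0<..<1}. (\<forall>n\<in>{1..N}. f n (x n \<omega>) = \<eta>) \<longrightarrow>
        c (\<lambda>n\<in>{1..N}. x n \<omega>) < \<eta>"
      by (rule conjunction_criterion[OF sys N K H1 bspec[OF f] c])
  next
    fix M :: "'w measure" and N \<pi>s h x f c
    assume N: "1 < N" and sys: "independent_systems_on M H X K N \<pi>s h x"
      and f: "\<forall>n\<in>{1..N}. is_posterior H X K (\<pi>s n) H1 (f n)"
      and c: "is_cond_prob M {\<omega> \<in> space M. \<exists>n\<in>{1..N}. h n \<omega> \<in> H1} (PiM {1..N} (\<lambda>_. X))
          (\<lambda>\<omega>. \<lambda>n\<in>{1..N}. x n \<omega>) c"
    show "AE \<omega> in M. \<forall>\<eta>\<in>{0<..<1}. (\<forall>n\<in>{1..N}. f n (x n \<omega>) = \<eta>) \<longrightarrow>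
        c (\<lambda>n\<in>{1..N}. x n \<omega>) > \<eta>"
      by (rule disjunction_criterion[OF sys N K H1 bspec[OF f] c])
  next
    fix M :: "'w measure" and N \<pi>s h x f c
    assume N: "N \<ge> 1" and sys: "independent_systems_on M H X K N \<pi>s h x"
      and f: "is_posterior H X K (\<pi>s 1) H1 f"
      and c: "is_cond_prob M {\<omega> \<in> space M. h 1 \<omega> \<in> H1} (PiM {1..N} (\<lambda>_. X))
          (\<lambda>\<omega>. \<lambda>n\<in>{1..N}. x n \<omega>) c"
    show "AE \<omega> in M. c (\<lambda>n\<in>{1..N}. x n \<omega>) = f (x 1 \<omega>)"
      by (rule multiplicity_criterion[OF sys N K H1 f c])
  next
    fix Y :: "nat \<Rightarrow> 'y measure" and L post and \<eta> :: real
    assume L: "\<forall>i\<ge>1. L i \<in> measurable H (prob_algebra (Y i))"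
      and "\<forall>k. is_seq_posterior H Y L \<pi> H1 k (post k)"
    then have post: "post k \<in> borel_measurable (PiM {1..k} Y)" for k
      by (simp add: is_seq_posterior_def is_cond_prob_def Let_def)
    show "\<exists>D. analysis_plan Y post \<eta> D \<and> (\<forall>D'. analysis_plan Y post \<eta> D' \<longrightarrow>
        (\<forall>h\<in>H1. \<forall>k. conclude_prob L D k h \<ge> conclude_prob L D' k h))"
    proof (intro exI[of _ "threshold_plan \<eta> post"] conjI allI impI ballI)
      show "analysis_plan Y post \<eta> (threshold_plan \<eta> post)"
        by (rule analysis_plan_threshold[OF post])
      fix D' h k
      assume D': "analysis_plan Y post \<eta> D'" and "h \<in> H1"
      then have h: "h \<in> space H" using sets.sets_into_space[OF H1] by auto
      show "conclude_prob L D' k h \<le> conclude_prob L (threshold_plan \<eta> post) k h"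
        using L by (intro conclude_prob_le_threshold_plan[OF _ post D' h]) auto
    qed
  qed
qed

end
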